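(* Let $u$ minimize $\mathcal{E}_\phi$ over $X_{\phi,\omega}$ and assume that $\operatorname{supp}(\zeta'(u))\neq\mathbb{T}_\ell$. Then there exists $\beta^\star=(\beta_1,\dots,\beta_d)\in\mathbb{T}_\ell$ such that $u$ is equal to its iterated Steiner symmetrization with respect to $x_1=\beta_1,\ x_2=\beta_2,\dots,\ x_d=\beta_d$; that is, the translate $v(x):=u(x+\beta^\star)$ satisfies $v=v^\star$ on $\mathbb{T}_\ell$, where $v^\star$ is the iterated Steiner symmetrization of $v$.
   Context: Let $d\ge2$ and $I_\ell:=[-\ell,\ell]$ with endpoints identified; $\mathbb{T}_\ell:=I_\ell\times\dots\times I_\ell$ ($d$ factors), with coordinates $x=(x_1,\dots,x_d)$. Energy: for $\phi>0$, $$\mathcal{E}_\phi(u)=\int_{\mathbb{T}_\ell}\frac{\phi}{2}|Du|^2+\frac1\phi G(u)\,dx,$$ where $G\in C^2(\mathbb{R})$ is a nonnegative double-well potential with zeros at $\pm1$ (e.g. $G(s)=\frac14(1-s^2)^2$). Let $\zeta:\mathbb{R}\to[0,1]$ be a smooth monotone function with $\zeta(s)=1$ for $s\ge 1-\phi^{1/3}$ and $\zeta(s)=0$ for $s\le 1-2\phi^{1/3}$. With $\overline u:=\frac{1}{|\mathbb{T}_\ell|}\int_{\mathbb{T}_\ell}u\,dx$, set $$X_{\phi,\omega}:=\left\{u\in W^{1,2}(\mathbb{T}_\ell):\ \overline u=-1+\phi,\ \int_{\mathbb{T}_\ell}\zeta(u)\,dx=\omega\right\},$$ functions on $\mathbb{T}_\ell$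 being $2\ell$-periodic in each variable. The parameter regime is $\ell=\phi L/2$, $\phi=\xi L^{-d/(d+1)}$, with $L,\xi>0$. Minimizers of $\mathcal{E}_\phi$ over $X_{\phi,\omega}$ are (as is taken to be known) smooth and satisfy, for some Lagrange parameters $\lambda_\phi,\lambda_\omega\in\mathbb{R}$, $-\Delta u+\frac1{\phi^2}G'(u)+\frac1\phi(\lambda_\phi+\lambda_\omega\zeta'(u))=0$ in $\mathbb{T}_\ell$. Steiner symmetrization with respect to $\{x_i=0\}$: for a set $C\subseteq\mathbb{T}_\ell$ with measurable one-dimensional slices in direction $x_i$, replace each nonempty slice (with the other coordinates fixed) by the interval $\{|x_i|\le\frac12\mathcal{L}^1(\text{slice})\}$ (empty slices stay empty), giving $C^s_i$; here $\mathcal{L}^1$ is Lebesgue measure. For a function $u$, with $\Omega_t:=\{x: u(x)>t\}$, set $u^s_i(x):=\sup\{t\in\mathbb{R}: x\in(\Omega_t)^s_i\}$. The iterated Steiner symmetrization $u^\star$ of $u$ is obtained by symmetrizing first with respect to $\{x_d=0\}$, then $\{x_{d-1}=0\}$, and so on through $\{x_1=0\}$. *)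

theory Defs
  imports "HOL-Analysis.Analysis"
begin

text \<open>
  The coordinates \<open>x\<^sub>1, \<dots>, x\<^sub>d\<close> are indexed by a finite linearly ordered type \<open>'n\<close> with
  \<open>d = CARD('n)\<close>; the order is only used to fix the order of the iterated symmetrization.
  A function on the torus is a function on the whole space that is \<open>2l\<close>-periodic in each variable;
  \<open>torus l\<close> is the fundamental cell, over which all integrals are taken.
\<close>

definition torus :: "real \<Rightarrow> (real ^ 'n) set" where
  "torus l = cbox (\<chi> i. - l) (\<chi> i. l)"

definition periodic :: "real \<Rightarrow> (real ^ 'n \<Rightarrow> 'b) \<Rightarrow> bool" where
  "periodic l u \<longleftrightarrow> (\<forall>x i. u (x + axis i (2 * l)) = u x)"

abbreviation torus_measure :: "real \<Rightarrow> (real ^ 'n) measure" where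
  "torus_measure l \<equiv> lebesgue_on (torus l)"


subsection \<open>Classical derivatives\<close>

primrec Ck :: "nat \<Rightarrow> ('a::euclidean_space \<Rightarrow> real) \<Rightarrow> bool" where
  "Ck 0 f \<longleftrightarrow> continuous_on UNIV f"
| "Ck (Suc k) f \<longleftrightarrow> (\<forall>x. f differentiable (at x)) \<and>
     (\<forall>b\<in>Basis. Ck k (\<lambda>x. frechet_derivative f (at x) b))"

definition smooth :: "('a::euclidean_space \<Rightarrow> real) \<Rightarrow> bool" where
  "smooth f \<longleftrightarrow> (\<forall>k. Ck k f)"

definition partial :: "'n \<Rightarrow> (real ^ 'n \<Rightarrow> real) \<Rightarrow> real ^ 'n \<Rightarrow> real" where
  "partial i f x = frechet_derivative f (at x) (axis i 1)"

definition laplacian :: "(real ^ 'n \<Rightarrow> real) \<Rightarrow> real ^ 'n \<Rightarrow> real" where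
  "laplacian f x = (\<Sum>i\<in>UNIV. partial i (partial i f) x)"


subsection \<open>The Sobolev space \<open>W\<^sup>1\<^sup>,\<^sup>2\<close> of the torus\<close>

definition is_weak_gradient ::
    "real \<Rightarrow> (real ^ 'n \<Rightarrow> real) \<Rightarrow> (real ^ 'n \<Rightarrow> real ^ 'n) \<Rightarrow> bool" where
  "is_weak_gradient l u g \<longleftrightarrow>
     g \<in> borel_measurable (torus_measure l) \<and>
     integrable (torus_measure l) (\<lambda>x. (norm (g x))\<^sup>2) \<and>
     (\<forall>\<psi> i. smooth \<psi> \<longrightarrow> periodic l \<psi> \<longrightarrow>
        (\<integral>x. u x * partial i \<psi> x \<partial>torus_measure l) = - (\<integral>x. g x $ i * \<psi> x \<partial>torus_measure l))"

definition W12 :: "real \<Rightarrow> (real ^ 'n \<Rightarrow> real) set" where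
  "W12 l = {u. periodic l u \<and> u \<in> borel_measurable (torus_measure l) \<and>
     integrable (torus_measure l) (\<lambda>x. (u x)\<^sup>2) \<and> (\<exists>g. is_weak_gradient l u g)}"

text \<open>The weak gradient is unique up to null sets of the cell, so the choice is immaterial below.\<close>

definition weak_gradient :: "real \<Rightarrow> (real ^ 'n \<Rightarrow> real) \<Rightarrow> real ^ 'n \<Rightarrow> real ^ 'n" where
  "weak_gradient l u = (SOME g. is_weak_gradient l u g)"


subsection \<open>The constrained minimization problem\<close>

text \<open>
  The energy takes values in \<^typ>\<open>ennreal\<close>: no growth condition is imposed on \<open>G\<close>, so \<open>G(u)\<close> need
  not be integrable, and then the energy has to be \<open>\<infinity>\<close>.
\<close>

definition energy ::
    "real \<Rightarrow> real \<Rightarrow> (real \<Rightarrow> real) \<Rightarrow> (real ^ 'n \<Rightarrow> real) \<Rightarrow> ennreal" where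
  "energy \<phi> l G u =
     (\<integral>\<^sup>+ x. ennreal (\<phi> / 2 * (norm (weak_gradient l u x))\<^sup>2 + 1 / \<phi> * G (u x)) \<partial>torus_measure l)"

definition torus_average :: "real \<Rightarrow> (real ^ 'n \<Rightarrow> real) \<Rightarrow> real" where
  "torus_average l u =
     1 / measure lebesgue (torus l :: (real ^ 'n) set) * (\<integral>x. u x \<partial>torus_measure l)"

definition admissible ::
    "real \<Rightarrow> real \<Rightarrow> (real \<Rightarrow> real) \<Rightarrow> real \<Rightarrow> (real ^ 'n \<Rightarrow> real) set" where
  "admissible \<phi> l \<zeta> \<omega> = {u \<in> W12 l.
     torus_average l u = - 1 + \<phi> \<and> (\<integral>x. \<zeta> (u x) \<partial>torus_measure l) = \<omega>}"

definition minimizer ::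
    "real \<Rightarrow> real \<Rightarrow> (real \<Rightarrow> real) \<Rightarrow> (real \<Rightarrow> real) \<Rightarrow> real \<Rightarrow> (real ^ 'n \<Rightarrow> real) \<Rightarrow> bool" where
  "minimizer \<phi> l G \<zeta> \<omega> u \<longleftrightarrow>
     u \<in> admissible \<phi> l \<zeta> \<omega> \<and>
     (\<forall>w :: real ^ 'n \<Rightarrow> real. w \<in> admissible \<phi> l \<zeta> \<omega> \<longrightarrow> energy \<phi> l G u \<le> energy \<phi> l G w)"

definition double_well :: "(real \<Rightarrow> real) \<Rightarrow> bool" where
  "double_well G \<longleftrightarrow> Ck 2 G \<and> (\<forall>s. G s \<ge> 0) \<and> (\<forall>s. G s = 0 \<longleftrightarrow> s = 1 \<or> s = - 1)"

definition cutoff :: "real \<Rightarrow> (real \<Rightarrow> real) \<Rightarrow> bool" where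
  "cutoff \<phi> \<zeta> \<longleftrightarrow> smooth \<zeta> \<and> mono \<zeta> \<and> (\<forall>s. 0 \<le> \<zeta> s \<and> \<zeta> s \<le> 1) \<and>
     (\<forall>s \<ge> 1 - \<phi> powr (1/3). \<zeta> s = 1) \<and> (\<forall>s \<le> 1 - 2 * \<phi> powr (1/3). \<zeta> s = 0)"

text \<open>\<open>\<mu>\<close> and \<open>\<nu>\<close> are the Lagrange parameters of the mean and of the volume constraint.\<close>

definition euler_lagrange ::
    "real \<Rightarrow> (real \<Rightarrow> real) \<Rightarrow> (real \<Rightarrow> real) \<Rightarrow> real \<Rightarrow> real \<Rightarrow> (real ^ 'n \<Rightarrow> real) \<Rightarrow> bool" where
  "euler_lagrange \<phi> G \<zeta> \<mu> \<nu> u \<longleftrightarrow>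
     (\<forall>x. - laplacian u x + 1 / \<phi>\<^sup>2 * deriv G (u x)
            + 1 / \<phi> * (\<mu> + \<nu> * deriv \<zeta> (u x)) = 0)"

text \<open>
  Minimizers are determined only up to null sets, so regularity is a statement about a representative.
  Only \<open>C\<^sup>2\<close> is asked for, as the equation needs; for a potential that is merely \<open>C\<^sup>2\<close>,
  infinite differentiability could not be expected.
\<close>

definition regular_minimizers ::
    "real \<Rightarrow> real \<Rightarrow> (real \<Rightarrow> real) \<Rightarrow> (real \<Rightarrow> real) \<Rightarrow> real \<Rightarrow> 'n::finite itself \<Rightarrow> bool" where
  "regular_minimizers \<phi> l G \<zeta> \<omega> (_ :: 'n::finite itself) \<longleftrightarrow>
     (\<forall>w :: real ^ 'n \<Rightarrow> real. minimizer \<phi> l G \<zeta> \<omega> w \<longrightarrow>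
        (\<exists>v \<mu> \<nu>. (AE x in lebesgue. v x = w x) \<and> Ck 2 v \<and> euler_lagrange \<phi> G \<zeta> \<mu> \<nu> v))"


subsection \<open>Steiner symmetrization\<close>

definition slice :: "'n \<Rightarrow> (real ^ 'n) set \<Rightarrow> real ^ 'n \<Rightarrow> real set" where
  "slice i C x = {s. (\<chi> j. if j = i then s else x $ j) \<in> C}"

definition steiner_set :: "real \<Rightarrow> 'n \<Rightarrow> (real ^ 'n) set \<Rightarrow> (real ^ 'n) set" where
  "steiner_set l i C =
     {x \<in> torus l. slice i C x \<noteq> {} \<and> \<bar>x $ i\<bar> \<le> measure lebesgue (slice i C x) / 2}"

text \<open>
  For \<open>u\<close> bounded on the cell and \<open>x\<close> in the cell, the supremum is that of a nonempty bounded set.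
  Values outside the cell are not meaningful.
\<close>

definition steiner :: "real \<Rightarrow> 'n \<Rightarrow> (real ^ 'n \<Rightarrow> real) \<Rightarrow> real ^ 'n \<Rightarrow> real" where
  "steiner l i u x = Sup {t. x \<in> steiner_set l i {y \<in> torus l. u y > t}}"

text \<open>Since \<^const>\<open>foldr\<close> is used, the largest index is symmetrized first and the smallest last.\<close>

definition iterated_steiner ::
    "real \<Rightarrow> ((real, 'n::{finite,linorder}) vec \<Rightarrow> real) \<Rightarrow> (real, 'n) vec \<Rightarrow> real" where
  "iterated_steiner l u = foldr (steiner l) (sorted_list_of_set UNIV) u"

end

theory Submission imports Defs begin

text \<open>
  The proof is by polarization. Fix a coordinate \<open>i\<close> and a number \<open>a\<close>, let \<open>R\<close> be the reflection
  \<open>x\<^sub>i \<mapsto> 2a - x\<^sub>i\<close>, put \<open>w = u - u \<circ> R\<close>, and let \<open>F\<close> be the larger of \<open>u\<close> and \<open>u \<circ> R\<close> on the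
  slab \<open>a < x\<^sub>i < a + l\<close> and the smaller one on the complementary slab. At each pair \<open>x, R x\<close> the
  values of \<open>F\<close> are those of \<open>u\<close>, possibly interchanged, so \<open>F\<close> satisfies the same constraints, and
  its energy is not larger: \<open>F\<close> is a minimizer as well (\<open>minimizer_polarize\<close>). By the regularity
  of minimizers and the continuity of \<open>F\<close>, the function \<open>F\<close> is \<open>C\<^sup>2\<close>, and on the slab so is
  \<open>|w| = 2F - u - u \<circ> R\<close>. Therefore the derivative of \<open>w\<close> vanishes at each zero of \<open>w\<close> in the
  slab. Both \<open>u\<close> and \<open>u \<circ> R\<close> solve \<open>\<Delta>u = f(u)\<close> with one and the same \<open>f\<close>
  of class \<open>C\<^sup>1\<close>, so that \<open>\<Delta>w \<le> K w\<close> where \<open>w > 0\<close>. Hopf's lemma (\<open>hopf\<close>), applied to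
  a ball inside \<open>{w > 0}\<close> that touches a zero of \<open>w\<close>, now shows that \<open>w\<close> has a fixed sign on the slab
  (\<open>reflection_dichotomy\<close>). The Lagrange parameters of \<open>F\<close>, which might differ from those of \<open>u\<close>,
  never enter.

  Thus for each \<open>a\<close> either \<open>u \<ge> u \<circ> R\<close> throughout the slab or \<open>u \<le> u \<circ> R\<close> throughout. The two closed
  sets of numbers \<open>a\<close> so defined cover the line and are exchanged by translation by \<open>l\<close>, so they
  meet, and \<open>u\<close> is symmetric in \<open>x\<^sub>i\<close> about a point of the intersection. A further connectedness
  argument gives a centre \<open>\<beta>\<^sub>i\<close> around which \<open>u\<close> is decreasing in \<open>x\<^sub>i\<close> on a half period
  (\<open>symmetric_decreasing_centre\<close>). A continuous function that is symmetric and decreasing in \<open>x\<^sub>i\<close>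
  about \<open>0\<close> is fixed by Steiner symmetrization in \<open>x\<^sub>i\<close>, hence \<open>u(\<cdot> + \<beta>)\<close> is fixed by each step of
  the iteration.

  Two points of measure theory support the energy comparison. The energy is defined
  through an arbitrarily chosen weak gradient, so weak gradients are shown to be unique up to null
  sets (\<open>weak_gradient_unique\<close>). The weak gradient of \<open>F\<close> is found from symmetric difference
  quotients and the invariance of integrals of periodic functions under translations. At a point
  of the open slabs where \<open>w = 0\<close>, the symmetric difference quotients of \<open>|w|\<close> tend to \<open>0\<close> whether
  or not \<open>w\<close> has a nonzero derivative there, so no information on the zero set of \<open>w\<close> is needed; the resulting
  gradient of \<open>F\<close> is a convex combination of those of \<open>u\<close> and \<open>u \<circ> R\<close>.
\<close>

section \<open>Smooth functions\<close>

lemma has_derivative_imp_frechet: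
  assumes "\<And>x. (f has_derivative D x) (at x)"
  shows "f differentiable (at x)" "frechet_derivative f (at x) = D x"
  using assms[of x] frechet_derivative_at[OF assms[of x]] by (auto simp: differentiable_def)

text \<open>Introduction and elimination of \<^const>\<open>Ck\<close> with an arbitrary expression for the derivative.\<close>

lemma Ck_SucI:
  assumes "\<And>x. (f has_derivative D x) (at x)" "\<And>b. b \<in> Basis \<Longrightarrow> Ck k (\<lambda>x. D x b)"
  shows "Ck (Suc k) f"
  using assms has_derivative_imp_frechet[of f D] by simp

lemma Ck_SucE:
  assumes "Ck (Suc k) f"
  obtains D where "\<And>x. (f has_derivative D x) (at x)" "\<And>b. b \<in> Basis \<Longrightarrow> Ck k (\<lambda>x. D x b)"
  using assms that[of "\<lambda>x. frechet_derivative f (at x)"]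
  by (auto simp: frechet_derivative_works)

lemma Ck_SucD: "Ck (Suc k) f \<Longrightarrow> Ck k f"
proof (induction k arbitrary: f)
  case 0
  then show ?case
    by (auto intro!: differentiable_imp_continuous_on simp: differentiable_on_def
        differentiable_at_withinI)
next
  case (Suc k)
  then show ?case by (simp only: Ck.simps) auto
qed

lemma Ck_imp_continuous: "Ck k f \<Longrightarrow> continuous_on UNIV f"
  by (induction k) (auto dest: Ck_SucD simp del: Ck.simps(2))

lemma Ck_const: "Ck k (\<lambda>x. c)"
proof (induction k arbitrary: c)
  case (Suc k)
  show ?case by (rule Ck_SucI[OF has_derivative_const Suc])
qed auto

lemma Ck_linear: "bounded_linear f \<Longrightarrow> Ck k f"
proof (cases k)
  case (Suc k')
  assume "bounded_linear f"
  then show ?thesis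
    unfolding Suc by (intro Ck_SucI[of f "\<lambda>_. f"] bounded_linear_imp_has_derivative Ck_const)
qed (auto intro: linear_continuous_on)

lemma Ck_add:
  assumes "Ck k f" "Ck k g"
  shows "Ck k (\<lambda>x. f x + g x)"
  using assms
proof (induction k arbitrary: f g)
  case 0
  then show ?case by (auto intro!: continuous_intros)
next
  case (Suc k)
  obtain D where D: "\<And>x. (f has_derivative D x) (at x)" "\<And>b. b \<in> Basis \<Longrightarrow> Ck k (\<lambda>x. D x b)"
    using Ck_SucE[OF Suc.prems(1)] by blast
  obtain E where E: "\<And>x. (g has_derivative E x) (at x)" "\<And>b. b \<in> Basis \<Longrightarrow> Ck k (\<lambda>x. E x b)"
    using Ck_SucE[OF Suc.prems(2)] by blast
  show ?case
    by (rule Ck_SucI[OF has_derivative_add[OF D(1) E(1)]]) (intro Suc.IH D E)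
qed

lemma Ck_sum:
  assumes "\<And>i. i \<in> I \<Longrightarrow> Ck k (f i)"
  shows "Ck k (\<lambda>x. \<Sum>i\<in>I. f i x)"
  using assms by (induction I rule: infinite_finite_induct) (auto intro: Ck_const Ck_add)

lemma Ck_mult:
  assumes "Ck k f" "Ck k g"
  shows "Ck k (\<lambda>x. f x * g x)"
  using assms
proof (induction k arbitrary: f g)
  case 0
  then show ?case by (auto intro!: continuous_intros)
next
  case (Suc k)
  obtain D where D: "\<And>x. (f has_derivative D x) (at x)" "\<And>b. b \<in> Basis \<Longrightarrow> Ck k (\<lambda>x. D x b)"
    using Ck_SucE[OF Suc.prems(1)] by blast
  obtain E where E: "\<And>x. (g has_derivative E x) (at x)" "\<And>b. b \<in> Basis \<Longrightarrow> Ck k (\<lambda>x. E x b)"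
    using Ck_SucE[OF Suc.prems(2)] by blast
  show ?case
    by (rule Ck_SucI[OF has_derivative_mult[OF D(1) E(1)]])
      (intro Ck_add Suc.IH D E Suc.prems[THEN Ck_SucD])
qed

lemma Ck_cmult: "Ck k f \<Longrightarrow> Ck k (\<lambda>x. c * f x)"
  by (intro Ck_mult Ck_const)

lemma Ck_exp:
  assumes "Ck k f"
  shows "Ck k (\<lambda>x. exp (f x))"
  using assms
proof (induction k)
  case 0
  then show ?case by (auto intro!: continuous_intros)
next
  case (Suc k)
  obtain D where D: "\<And>x. (f has_derivative D x) (at x)" "\<And>b. b \<in> Basis \<Longrightarrow> Ck k (\<lambda>x. D x b)"
    using Ck_SucE[OF Suc.prems] by blast
  have "((\<lambda>x. exp (f x)) has_derivative (\<lambda>h. exp (f x) * D x h)) (at x)" for x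
    by (auto intro!: derivative_eq_intros D(1) simp: algebra_simps)
  then show ?case
    by (rule Ck_SucI) (intro Ck_mult D Suc.IH Suc.prems[THEN Ck_SucD])
qed

lemma Ck_sin_cos:
  assumes "Ck k f"
  shows "Ck k (\<lambda>x. sin (f x)) \<and> Ck k (\<lambda>x. cos (f x))"
  using assms
proof (induction k)
  case 0
  then show ?case by (auto intro!: continuous_intros)
next
  case (Suc k)
  obtain D where D: "\<And>x. (f has_derivative D x) (at x)" "\<And>b. b \<in> Basis \<Longrightarrow> Ck k (\<lambda>x. D x b)"
    using Ck_SucE[OF Suc.prems] by blast
  have IH: "Ck k (\<lambda>x. sin (f x))" "Ck k (\<lambda>x. cos (f x))"
    using Suc.IH Suc.prems[THEN Ck_SucD] by auto
  have s: "((\<lambda>x. sin (f x)) has_derivative (\<lambda>h. cos (f x) * D x h)) (at x)"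
    and c: "((\<lambda>x. cos (f x)) has_derivative (\<lambda>h. -1 * (sin (f x) * D x h))) (at x)" for x
    by (auto intro!: derivative_eq_intros D(1) simp: algebra_simps)
  show ?case
    by (intro conjI Ck_SucI[OF s] Ck_SucI[OF c] Ck_mult Ck_cmult IH D)
qed

section \<open>Lines and partial derivatives\<close>

lemma Ck1_has_derivative_line:
  fixes f :: "real ^ 'n \<Rightarrow> real"
  assumes "Ck (Suc k) f"
  shows "((\<lambda>s. f (x + axis j s)) has_real_derivative partial j f (x + axis j s)) (at s)"
proof -
  define D where "D x = frechet_derivative f (at x)" for x
  have D: "(f has_derivative D x) (at x)" for x
    using assms by (simp add: D_def frechet_derivative_works[symmetric])
  have ax: "axis j h = h *\<^sub>R axis j (1::real)" for h
    by (simp add: vec_eq_iff axis_def)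
  have l: "((\<lambda>s. x + s *\<^sub>R axis j (1::real)) has_derivative (\<lambda>h. h *\<^sub>R axis j 1)) (at s)"
    by (auto intro!: derivative_eq_intros)
  have "((\<lambda>s. f (x + s *\<^sub>R axis j 1)) has_derivative
      (\<lambda>h. D (x + s *\<^sub>R axis j 1) (h *\<^sub>R axis j 1))) (at s)"
    by (rule has_derivative_compose[OF l D])
  moreover have "D y (h *\<^sub>R axis j 1) = partial j f y * h" for h y
  proof -
    have "D y (h *\<^sub>R axis j 1) = h *\<^sub>R D y (axis j 1)"
      by (rule linear_scale[OF has_derivative_linear[OF D]])
    also have "D y (axis j 1) = partial j f y"
      by (simp add: partial_def D_def)
    finally show ?thesis by (simp only: real_scaleR_def mult.commute)
  qed
  ultimately show ?thesis
    unfolding has_field_derivative_def ax[of s] by (simp only: ax[symmetric])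
qed

lemma Ck_partial:
  fixes f :: "real ^ 'n \<Rightarrow> real"
  assumes "Ck (Suc k) f"
  shows "Ck k (partial j f)"
proof -
  have "axis j (1::real) \<in> Basis" by (simp add: axis_in_Basis_iff)
  then show ?thesis using assms by (simp add: partial_def [abs_def])
qed

lemma Ck_continuous_partial:
  fixes f :: "real ^ 'n \<Rightarrow> real"
  shows "Ck (Suc k) f \<Longrightarrow> continuous_on UNIV (partial j f)"
  using Ck_partial Ck_imp_continuous by blast

lemma partial_unique:
  fixes f :: "real ^ 'n \<Rightarrow> real"
  assumes "Ck (Suc k) f" "((\<lambda>s. f (x + axis j s)) has_real_derivative d) (at 0)"
  shows "partial j f x = d"
proof -
  have z: "x + axis j (0::real) = x" by (simp add: vec_eq_iff axis_def)
  show ?thesis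
    using DERIV_unique[OF Ck1_has_derivative_line[OF assms(1), of x j 0] assms(2)]
    by (simp only: z)
qed

section \<open>Integrals of periodic functions\<close>

lemma torus_iff: "x \<in> torus l \<longleftrightarrow> (\<forall>i. - l \<le> x $ i \<and> x $ i \<le> l)"
  by (simp add: torus_def mem_box_cart)

lemma torus_sets_borel [measurable]: "torus l \<in> sets borel"
  by (simp add: torus_def)

lemma torus_sets_lebesgue [simp]: "torus l \<in> sets lebesgue"
  by (simp add: torus_def)

lemma axis_nth_eq: "axis j h $ k = (if k = j then h else (0::real))"
  by (auto simp: axis_def)

lemma periodic_axis_int:
  assumes "periodic l f"
  shows "f (x + axis j (2 * l * of_int k)) = f x"
proof -
  have n: "f (x + axis j (2 * l * of_nat n)) = f x" for n x
  proof (induction n)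
    case 0
    have "x + axis j (2 * l * of_nat 0) = x" by (simp add: vec_eq_iff axis_def)
    then show ?case by (simp only:)
  next
    case (Suc n)
    have "x + axis j (2 * l * of_nat (Suc n)) = (x + axis j (2 * l * of_nat n)) + axis j (2 * l)"
      by (simp add: vec_eq_iff axis_def algebra_simps)
    then show ?case using assms Suc by (simp only: periodic_def)
  qed
  show ?thesis
  proof (cases k)
    case (nonneg n)
    then show ?thesis using n by simp
  next
    case (neg n)
    have "f (x + axis j (2 * l * of_int k) + axis j (2 * l * of_nat (Suc n)))
        = f (x + axis j (2 * l * of_int k))" by (rule n)
    moreover have "x + axis j (2 * l * of_int k) + axis j (2 * l * of_nat (Suc n)) = x"
      unfolding neg by (simp add: vec_eq_iff axis_def algebra_simps)
    ultimately show ?thesis by (simp only:)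
  qed
qed

lemma periodic_lattice:
  assumes "periodic l f"
  shows "f (x + (\<chi> i. 2 * l * of_int (k i))) = f (x :: real ^ 'n)"
proof -
  have "f (x + (\<chi> i. if i \<in> S then 2 * l * of_int (k i) else 0)) = f x" if "finite S" for S
    using that
  proof (induction S)
    case empty
    have "x + (\<chi> i. if i \<in> {} then 2 * l * of_int (k i) else 0) = x" by (simp add: vec_eq_iff)
    then show ?case by (simp only:)
  next
    case (insert j S)
    have "x + (\<chi> i. if i \<in> insert j S then 2 * l * of_int (k i) else 0)
       = x + (\<chi> i. if i \<in> S then 2 * l * of_int (k i) else 0) + axis j (2 * l * of_int (k j))"
      using insert by (auto simp: vec_eq_iff axis_def)
    then show ?case using insert periodic_axis_int[OF assms] by (simp only:)
  qed
  from this[of UNIV] show ?thesis by simp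
qed

lemma torus_representative:
  assumes "0 < l"
  obtains y k where "y \<in> torus l" "x = y + (\<chi> i. 2 * l * of_int (k i))"
proof
  define k where "k i = \<lfloor>(x $ i + l) / (2 * l)\<rfloor>" for i
  define y where "y = x - (\<chi> i. 2 * l * of_int (k i))"
  show "x = y + (\<chi> i. 2 * l * of_int (k i))" by (simp add: y_def)
  have "of_int (k i) \<le> (x $ i + l) / (2 * l)" "(x $ i + l) / (2 * l) < of_int (k i) + 1" for i
    by (auto simp: k_def)
  then show "y \<in> torus l"
    using assms by (auto simp: torus_iff y_def field_simps intro: less_imp_le)
qed

lemma periodic_bounded:
  fixes f :: "real ^ 'n \<Rightarrow> real"
  assumes "0 < l" "periodic l f" "continuous_on UNIV f"
  obtains M where "\<And>x. \<bar>f x\<bar> \<le> M" "0 \<le> M"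
proof -
  have "compact (f ` torus l)"
    by (intro compact_continuous_image continuous_on_subset[OF assms(3)])
      (auto simp: torus_def)
  then obtain M where M: "\<And>x. x \<in> torus l \<Longrightarrow> \<bar>f x\<bar> \<le> M"
    using compact_imp_bounded[of "f ` torus l"] by (auto simp: bounded_iff)
  have "\<bar>f x\<bar> \<le> \<bar>M\<bar>" for x
    using torus_representative[OF assms(1), of x] periodic_lattice[OF assms(2)] M
    by (metis abs_ge_self order_trans)
  then show ?thesis using that[of "\<bar>M\<bar>"] by simp
qed

lemma finite_torus_measure: "finite_measure (torus_measure l)"
  by (rule finite_measureI) (simp add: emeasure_restrict_space torus_def emeasure_lborel_cbox_eq)

lemma integral_torus:
  fixes f :: "real ^ 'n \<Rightarrow> real"
  assumes "f \<in> borel_measurable borel"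
  shows "(\<integral>x. f x \<partial>torus_measure l) = (\<integral>x. indicator (torus l) x * f x \<partial>lborel)"
  using assms by (subst integral_restrict_space) (auto intro!: integral_completion)

lemma integrable_torus:
  fixes f :: "real ^ 'n \<Rightarrow> real"
  assumes "f \<in> borel_measurable borel" "\<And>x. \<bar>f x\<bar> \<le> M"
  shows "integrable (torus_measure l) f"
proof -
  interpret finite_measure "torus_measure l :: (real ^ 'n) measure" by (rule finite_torus_measure)
  show ?thesis
    by (rule integrable_const_bound[of _ M])
      (use assms in \<open>auto intro!: measurable_restrict_space1 measurable_completion\<close>)
qed

lemma integrable_indicator_torus:
  fixes f :: "real ^ 'n \<Rightarrow> real"
  assumes "f \<in> borel_measurable borel" "\<And>x. \<bar>f x\<bar> \<le> M"
  shows "integrable lborel (\<lambda>x. indicator (torus l) x * f x)"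
proof (rule Bochner_Integration.integrable_bound)
  show "integrable lborel (\<lambda>x::real ^ 'n. indicator (torus l) x * M)"
    by (intro integrable_mult_left integrable_real_indicator) (auto simp: torus_def emeasure_lborel_cbox_eq)
  show "(\<lambda>x. indicator (torus l) x * f x) \<in> borel_measurable lborel"
    using assms(1) by measurable
  show "AE x in lborel. norm (indicator (torus l) x * f x) \<le> norm (indicator (torus l) x * M)"
    by (rule always_eventually)
      (use assms(2) in \<open>auto simp: indicator_def intro: order_trans[OF _ abs_ge_self]\<close>)
qed

lemma lborel_integral_shift:
  fixes f :: "'a::euclidean_space \<Rightarrow> real"
  assumes [measurable]: "f \<in> borel_measurable borel"
  shows "(\<integral>x. f (c + x) \<partial>lborel) = (\<integral>x. f x \<partial>lborel)"
proof -
  have "(\<integral>x. f x \<partial>lborel) = (\<integral>x. f x \<partial>distr lborel borel ((+) c))"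
    by (simp add: lborel_distr_plus)
  also have "\<dots> = (\<integral>x. f (c + x) \<partial>lborel)"
    by (rule integral_distr) auto
  finally show ?thesis ..
qed

lemma AE_coordinate_neq: "AE x in (lborel :: (real ^ 'n) measure). x $ j \<noteq> c"
proof -
  have "negligible {x :: real ^ 'n. axis j 1 \<bullet> x = c}"
    by (rule negligible_hyperplane) (simp add: axis_eq_0_iff)
  then have "{x :: real ^ 'n. x $ j = c} \<in> null_sets lebesgue"
    by (simp add: negligible_iff_null_sets inner_axis' )
  moreover have "{x :: real ^ 'n. x $ j = c} \<in> sets borel"
    by simp
  ultimately have "{x :: real ^ 'n. x $ j = c} \<in> null_sets lborel"
    by (simp add: null_sets_def)
  then show ?thesis by (rule AE_I') auto
qed

text \<open>
  The shifted cell sticks out of the cell by a slab of width \<open>h\<close>. The function \<open>Q\<close> is the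
  restriction of \<open>f\<close> to the slab missing at the other end, which is a translate of it by \<open>2l\<close>.
\<close>

lemma integral_torus_shift_small:
  fixes f :: "real ^ 'n \<Rightarrow> real"
  assumes [measurable]: "f \<in> borel_measurable borel" and M: "\<And>x. \<bar>f x\<bar> \<le> M"
    and per: "periodic l f" and h: "0 \<le> h" "h \<le> 2 * l"
  shows "(\<integral>x. f (x + axis j h) \<partial>torus_measure l) = (\<integral>x. f x \<partial>torus_measure l)"
proof -
  let ?A = "indicator (torus l) :: real ^ 'n \<Rightarrow> real"
  define P where "P x = ?A x * (if h - l \<le> x $ j then f x else 0)" for x
  define Q where "Q x = ?A x * (if x $ j \<le> h - l then f x else 0)" for x
  have [measurable]: "P \<in> borel_measurable borel" "Q \<in> borel_measurable borel"
    unfolding P_def Q_def by measurable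
  have M0: "0 \<le> M" using M[of 0] by linarith
  have intP: "integrable lborel P" and intQ: "integrable lborel Q"
    unfolding P_def Q_def
    by (rule integrable_indicator_torus[of _ M], measurable, auto simp: M M0)+
  have intQ': "integrable lborel (\<lambda>x. Q (- axis j (2 * l) + x))"
    using intQ
    by (subst integrable_distr_eq[of "(+) (- axis j (2 * l))" lborel borel Q, symmetric])
      (auto simp: lborel_distr_plus)
  have per': "f (- axis j (2 * l) + x) = f x" for x
    using per[unfolded periodic_def, rule_format, of "- axis j (2 * l) + x" j] by simp
  have ae: "AE x in lborel. ?A (- axis j h + x) * f x = P x + Q (- axis j (2 * l) + x)"
    using AE_coordinate_neq[of j l] AE_coordinate_neq[of j "h + l"] AE_coordinate_neq[of j "h - l"]
  proof eventually_elim
    case (elim x)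
    define R where "R \<longleftrightarrow> (\<forall>k. k \<noteq> j \<longrightarrow> - l \<le> x $ k \<and> x $ k \<le> l)"
    have t: "- axis j c + x \<in> torus l \<longleftrightarrow> R \<and> - l \<le> x $ j - c \<and> x $ j - c \<le> l" for c
      unfolding torus_iff R_def by (auto simp: axis_nth_eq)
    have t0: "x \<in> torus l \<longleftrightarrow> R \<and> - l \<le> x $ j \<and> x $ j \<le> l"
      unfolding torus_iff R_def by auto
    show ?case
      using elim h unfolding P_def Q_def indicator_def t t0 per' by (auto simp: axis_nth_eq)
  qed
  have "(\<integral>x. f (x + axis j h) \<partial>torus_measure l) = (\<integral>x. ?A x * f (x + axis j h) \<partial>lborel)"
    by (intro integral_torus) measurable
  also have "\<dots> = (\<integral>x. ?A (- axis j h + (axis j h + x)) * f (axis j h + x) \<partial>lborel)"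
    by (simp add: add.commute)
  also have "\<dots> = (\<integral>x. ?A (- axis j h + x) * f x \<partial>lborel)"
    by (rule lborel_integral_shift[of "\<lambda>x. ?A (- axis j h + x) * f x" "axis j h"]) measurable
  also have "\<dots> = (\<integral>x. P x + Q (- axis j (2 * l) + x) \<partial>lborel)"
    by (rule integral_cong_AE[OF _ _ ae]) measurable
  also have "\<dots> = (\<integral>x. P x \<partial>lborel) + (\<integral>x. Q (- axis j (2 * l) + x) \<partial>lborel)"
    by (rule Bochner_Integration.integral_add[OF intP intQ'])
  also have "(\<integral>x. Q (- axis j (2 * l) + x) \<partial>lborel) = (\<integral>x. Q x \<partial>lborel)"
    by (rule lborel_integral_shift) measurable
  also have "(\<integral>x. P x \<partial>lborel) + (\<integral>x. Q x \<partial>lborel) = (\<integral>x. P x + Q x \<partial>lborel)"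
    by (rule Bochner_Integration.integral_add[OF intP intQ, symmetric])
  also have "\<dots> = (\<integral>x. ?A x * f x \<partial>lborel)"
  proof (rule integral_cong_AE)
    show "AE x in lborel. P x + Q x = ?A x * f x"
      using AE_coordinate_neq[of j "h - l"] by eventually_elim (auto simp: P_def Q_def)
  qed measurable
  also have "\<dots> = (\<integral>x. f x \<partial>torus_measure l)"
    by (intro integral_torus[symmetric]) measurable
  finally show ?thesis .
qed

lemma integral_torus_shift:
  fixes f :: "real ^ 'n \<Rightarrow> real"
  assumes "0 < l" "f \<in> borel_measurable borel" "\<And>x. \<bar>f x\<bar> \<le> M" "periodic l f"
  shows "(\<integral>x. f (x + axis j h) \<partial>torus_measure l) = (\<integral>x. f x \<partial>torus_measure l)"
proof -
  define k where "k = \<lfloor>h / (2 * l)\<rfloor>"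
  define h' where "h' = h - 2 * l * of_int k"
  have "of_int k \<le> h / (2 * l)" "h / (2 * l) < of_int k + 1" by (auto simp: k_def)
  then have h': "0 \<le> h'" "h' \<le> 2 * l"
    using assms(1) by (auto simp: h'_def field_simps)
  have "x + axis j h = (x + axis j h') + axis j (2 * l * of_int k)" for x
    by (auto simp: vec_eq_iff axis_nth_eq h'_def)
  then have "f (x + axis j h) = f (x + axis j h')" for x
    using periodic_axis_int[OF assms(4), of "x + axis j h'" j k] by (simp only:)
  then show ?thesis
    using integral_torus_shift_small[OF assms(2-4) h'] by simp
qed

text \<open>The reflection \<open>x\<^sub>i \<mapsto> 2a - x\<^sub>i\<close>.\<close>

definition reflect :: "real \<Rightarrow> 'n \<Rightarrow> real ^ 'n \<Rightarrow> real ^ 'n" where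
  "reflect a i x = (\<chi> j. if j = i then 2 * a - x $ j else x $ j)"

lemma reflect_nth: "reflect a i x $ j = (if j = i then 2 * a - x $ j else x $ j)"
  by (simp add: reflect_def)

lemma reflect_reflect [simp]: "reflect a i (reflect a i x) = x"
  by (simp add: vec_eq_iff reflect_nth)

lemma reflect_eq: "reflect a i x = x + axis i (2 * (a - x $ i))"
  by (simp add: vec_eq_iff reflect_nth axis_nth_eq)

lemma reflect_add_axis:
  "reflect a i (x + axis j h) = reflect a i x + axis j (if j = i then - h else h)"
  by (auto simp: vec_eq_iff reflect_nth axis_nth_eq)

lemma continuous_on_reflect [continuous_intros]:
  "continuous_on S f \<Longrightarrow> continuous_on S (\<lambda>x. reflect a i (f x))"
  unfolding reflect_def
  by (intro continuous_on_vec_lambda, rename_tac j, case_tac "j = i") (auto intro!: continuous_intros)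

lemma measurable_reflect [measurable]: "reflect a i \<in> borel_measurable borel"
  by (intro borel_measurable_continuous_onI continuous_intros)

lemma periodic_reflect:
  assumes "periodic l f"
  shows "periodic l (\<lambda>x. f (reflect a i x))"
  unfolding periodic_def
proof (intro allI)
  fix x j
  show "f (reflect a i (x + axis j (2 * l))) = f (reflect a i x)"
    using periodic_axis_int[OF assms, of "reflect a i x" j 1]
      periodic_axis_int[OF assms, of "reflect a i x" j "-1"]
    by (auto simp: reflect_add_axis)
qed

lemma lborel_integral_reflect:
  fixes f :: "real ^ 'n \<Rightarrow> real"
  assumes [measurable]: "f \<in> borel_measurable borel"
  shows "(\<integral>x. f (reflect 0 i x) \<partial>lborel) = (\<integral>x. f x \<partial>lborel)"
proof -
  define c :: "real ^ 'n \<Rightarrow> real" where "c j = (if j = axis i 1 then -1 else 1)" for j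
  have r: "reflect 0 i = (\<lambda>x. 0 + (\<Sum>j\<in>Basis. (c j * (x \<bullet> j)) *\<^sub>R j))"
  proof
    fix x :: "real ^ 'n"
    have "(\<Sum>j\<in>Basis. (c j * (x \<bullet> j)) *\<^sub>R j) \<bullet> axis k 1 = c (axis k 1) * (x $ k)" for k
      by (subst inner_sum_left_Basis) (simp_all add: axis_in_Basis_iff inner_axis)
    moreover have "c (axis k 1) = (if k = i then -1 else 1)" for k
      by (simp add: c_def axis_eq_axis)
    ultimately have "reflect 0 i x $ k = (\<Sum>j\<in>Basis. (c j * (x \<bullet> j)) *\<^sub>R j) $ k" for k
      by (subst cart_eq_inner_axis[of "sum _ _"]) (simp add: reflect_nth inner_axis)
    then show "reflect 0 i x = 0 + (\<Sum>j\<in>Basis. (c j * (x \<bullet> j)) *\<^sub>R j)"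
      by (simp only: vec_eq_iff add_0_left) blast
  qed
  have "lborel = density (distr lborel borel (reflect 0 i)) (\<lambda>_. (\<Prod>j\<in>Basis. \<bar>c j\<bar>))"
    unfolding r by (rule lborel_affine_euclidean) (simp add: c_def)
  moreover have "(\<Prod>j\<in>Basis. \<bar>c j\<bar>) = 1"
    by (rule prod.neutral) (auto simp: c_def)
  ultimately have "lborel = distr lborel borel (reflect 0 i)"
    by (simp add: density_1)
  then have "(\<integral>x. f x \<partial>lborel) = (\<integral>x. f x \<partial>distr lborel borel (reflect 0 i))"
    by simp
  also have "\<dots> = (\<integral>x. f (reflect 0 i x) \<partial>lborel)"
    by (rule integral_distr) auto
  finally show ?thesis ..
qed

lemma integral_torus_reflect:
  fixes f :: "real ^ 'n \<Rightarrow> real"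
  assumes "0 < l" and [measurable]: "f \<in> borel_measurable borel"
    and "\<And>x. \<bar>f x\<bar> \<le> M" "periodic l f"
  shows "(\<integral>x. f (reflect a i x) \<partial>torus_measure l) = (\<integral>x. f x \<partial>torus_measure l)"
proof -
  have e: "reflect a i x = reflect 0 i x + axis i (2 * a)" for x
    by (simp add: vec_eq_iff reflect_nth axis_nth_eq)
  have t: "indicator (torus l) (reflect 0 i x) = (indicator (torus l) x :: real)" for x
    by (simp add: indicator_def torus_iff reflect_nth) (smt (verit))
  have "(\<integral>x. f (reflect a i x) \<partial>torus_measure l)
      = (\<integral>x. indicator (torus l) (reflect 0 i x) * f (reflect 0 i x + axis i (2 * a)) \<partial>lborel)"
    unfolding t e by (intro integral_torus) measurable
  also have "\<dots> = (\<integral>x. indicator (torus l) x * f (x + axis i (2 * a)) \<partial>lborel)"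
    by (rule lborel_integral_reflect[of "\<lambda>x. indicator (torus l) x * f (x + axis i (2 * a))"])
      measurable
  also have "\<dots> = (\<integral>x. f (x + axis i (2 * a)) \<partial>torus_measure l)"
    by (intro integral_torus[symmetric]) measurable
  also have "\<dots> = (\<integral>x. f x \<partial>torus_measure l)"
    by (rule integral_torus_shift[OF assms])
  finally show ?thesis .
qed

section \<open>Uniqueness of weak gradients\<close>

lemma AE_torusI: "(AE x in lborel. P x) \<Longrightarrow> (AE x in torus_measure l. P x)"
  by (subst AE_restrict_space_iff) (auto intro: AE_completion elim: eventually_mono)

lemma measurable_torusI: "f \<in> borel_measurable borel \<Longrightarrow> f \<in> borel_measurable (torus_measure l)"
  by (auto intro!: measurable_restrict_space1 measurable_completion)

lemma sets_torusI: "A \<in> sets borel \<Longrightarrow> A \<inter> torus l \<in> sets (torus_measure l)"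
  by (auto simp: sets_restrict_space)

lemma cos_less_near:
  assumes "\<bar>y\<bar> < \<rho>" "\<rho> \<le> l"
  shows "cos (pi / l * \<rho>) < cos (pi / l * y)"
proof -
  have l: "0 < l" using assms by linarith
  have "cos (pi / l * \<rho>) < cos (pi / l * \<bar>y\<bar>)"
    by (rule cos_monotone_0_pi) (use assms l in \<open>auto simp: field_simps\<close>)
  also have "cos (pi / l * \<bar>y\<bar>) = cos (pi / l * y)"
    by (cases "0 \<le> y") auto
  finally show ?thesis .
qed

lemma cos_less_far:
  assumes "0 \<le> \<rho>" "\<rho> < \<bar>y\<bar>" "\<bar>y\<bar> < 2 * l - \<rho>" "0 < l"
  shows "cos (pi / l * y) < cos (pi / l * \<rho>)"
proof -
  have "cos (pi / l * \<bar>y\<bar>) < cos (pi / l * \<rho>)"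
  proof (cases "\<bar>y\<bar> \<le> l")
    case True
    show ?thesis
      by (rule cos_monotone_0_pi) (use assms True in \<open>auto simp: field_simps\<close>)
  next
    case False
    have "pi / l * (2 * l - \<bar>y\<bar>) = 2 * pi - pi / l * \<bar>y\<bar>"
      using assms by (simp add: field_simps)
    then have "cos (pi / l * \<bar>y\<bar>) = cos (pi / l * (2 * l - \<bar>y\<bar>))"
      by (simp add: cos_diff)
    also have "\<dots> < cos (pi / l * \<rho>)"
    proof (rule cos_monotone_0_pi)
      show "pi / l * \<rho> < pi / l * (2 * l - \<bar>y\<bar>)"
        using assms by (intro mult_strict_left_mono) auto
    qed (use assms False in \<open>auto simp: field_simps\<close>)
    finally show ?thesis .
  qed
  also have "cos (pi / l * \<bar>y\<bar>) = cos (pi / l * y)"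
    by (cases "0 \<le> y") auto
  finally show ?thesis by simp
qed

text \<open>
  Smooth periodic functions with values in \<open>[0,1]\<close> that converge, as \<open>n \<rightarrow> \<infinity>\<close>, to the indicator
  function of the box with centre \<open>c\<close> and half side lengths \<open>\<rho>\<^sub>i\<close>.
\<close>

definition box_test :: "real \<Rightarrow> real ^ 'n \<Rightarrow> real ^ 'n \<Rightarrow> nat \<Rightarrow> real ^ 'n \<Rightarrow> real" where
  "box_test l c \<rho> n x =
     exp (- (\<Sum>i\<in>UNIV. exp (- (real n * (cos (pi / l * (x $ i - c $ i)) - cos (pi / l * \<rho> $ i))))))"

lemma smooth_box_test: "smooth (box_test l c \<rho> n)"
  unfolding smooth_def
proof
  fix k
  have eq: "box_test l c \<rho> n = (\<lambda>x. exp (\<Sum>i\<in>UNIV. -1 * exp ((- real n) *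
      (cos (pi / l * x $ i + (- (pi / l * c $ i))) + (- cos (pi / l * \<rho> $ i))))))"
    by (simp add: box_test_def fun_eq_iff sum_negf algebra_simps)
  show "Ck k (box_test l c \<rho> n)"
    unfolding eq
    by (intro Ck_exp Ck_sum Ck_cmult Ck_add Ck_const Ck_sin_cos[THEN conjunct2] Ck_linear
        bounded_linear_vec_nth)
qed

lemma periodic_box_test:
  fixes c :: "real ^ 'n"
  assumes l: "0 < l"
  shows "periodic l (box_test l c \<rho> n)"
proof -
  have "pi / l * (y + 2 * l - d) = pi / l * (y - d) + 2 * pi" for y d
    using l by (simp add: field_simps)
  then have "cos (pi / l * (y + 2 * l - d)) = cos (pi / l * (y - d))" for y d
    by (simp only: cos_periodic)
  then have "cos (pi / l * ((x + axis j (2 * l)) $ i - c $ i)) = cos (pi / l * (x $ i - c $ i))"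
    for x :: "real ^ 'n" and i j
    by (cases "i = j") (simp_all add: axis_nth_eq)
  then show ?thesis
    unfolding periodic_def box_test_def by (simp only:) simp
qed

lemma box_test_bounds: "0 \<le> box_test l c \<rho> n x" "box_test l c \<rho> n x \<le> 1"
  by (auto simp: box_test_def sum_nonneg)

lemma box_test_tendsto_1:
  fixes x c \<rho> :: "real ^ 'n"
  assumes "\<And>i. \<bar>x $ i - c $ i\<bar> < \<rho> $ i" "\<And>i. \<rho> $ i \<le> l"
  shows "(\<lambda>n. box_test l c \<rho> n x) \<longlonglongrightarrow> 1"
proof -
  define q where "q i = cos (pi / l * (x $ i - c $ i)) - cos (pi / l * \<rho> $ i)" for i
  have q: "0 < q i" for i
    using cos_less_near[OF assms] by (simp add: q_def)
  have "(\<lambda>n. exp (- (real n * q i))) \<longlonglongrightarrow> 0" for i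
  proof -
    have "filterlim (\<lambda>n. real n * q i) at_top sequentially"
      by (rule filterlim_at_top_mult_tendsto_pos[OF tendsto_const q filterlim_real_sequentially])
    then show ?thesis
      by (intro filterlim_compose[OF exp_at_bot]) (simp add: filterlim_uminus_at_bot)
  qed
  then have "(\<lambda>n. exp (- (\<Sum>i\<in>UNIV. exp (- (real n * q i))))) \<longlonglongrightarrow> exp (- (\<Sum>i\<in>(UNIV::'n set). 0))"
    by (intro tendsto_intros)
  then show ?thesis by (simp add: box_test_def q_def)
qed

lemma box_test_tendsto_0:
  fixes x c \<rho> :: "real ^ 'n"
  assumes "0 \<le> \<rho> $ k" "\<rho> $ k < \<bar>x $ k - c $ k\<bar>" "\<bar>x $ k - c $ k\<bar> < 2 * l - \<rho> $ k" "0 < l"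
  shows "(\<lambda>n. box_test l c \<rho> n x) \<longlonglongrightarrow> 0"
proof -
  define q where "q i = cos (pi / l * (x $ i - c $ i)) - cos (pi / l * \<rho> $ i)" for i
  have q: "0 < - q k"
    using cos_less_far[OF assms] by (simp add: q_def)
  have "filterlim (\<lambda>n. real n * - q k) at_top sequentially"
    by (rule filterlim_at_top_mult_tendsto_pos[OF tendsto_const q filterlim_real_sequentially])
  then have f: "filterlim (\<lambda>n. exp (real n * - q k)) at_top sequentially"
    by (rule filterlim_compose[OF exp_at_top])
  have g: "(\<lambda>n. exp (- exp (real n * - q k))) \<longlonglongrightarrow> 0"
    by (intro filterlim_compose[OF exp_at_bot]) (use f in \<open>simp add: filterlim_uminus_at_bot\<close>)
  show ?thesis
  proof (rule tendsto_sandwich[OF _ _ tendsto_const g])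
    have "exp (real n * - q k) \<le> (\<Sum>i\<in>UNIV. exp (- (real n * q i)))" for n
      using member_le_sum[of k UNIV "\<lambda>i. exp (- (real n * q i))"] by simp
    then show "\<forall>\<^sub>F n in sequentially. box_test l c \<rho> n x \<le> exp (- exp (real n * - q k))"
      by (simp add: box_test_def q_def)
  qed (simp add: box_test_bounds)
qed

lemma integral_box_zero:
  fixes h :: "real ^ 'n \<Rightarrow> real"
  assumes l: "0 < l" and h: "integrable (torus_measure l) h"
    and z: "\<And>\<psi>. smooth \<psi> \<Longrightarrow> periodic l \<psi> \<Longrightarrow> (\<integral>x. h x * \<psi> x \<partial>torus_measure l) = 0"
  shows "(\<integral>x. indicator (box a b) x * h x \<partial>torus_measure l) = 0"
proof -
  let ?M = "torus_measure l :: (real ^ 'n) measure"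
  define a' :: "real ^ 'n" where "a' = (\<chi> i. max (a $ i) (- l))"
  define b' :: "real ^ 'n" where "b' = (\<chi> i. min (b $ i) l)"
  have hm [measurable]: "h \<in> borel_measurable ?M" using h by auto
  have inT: "AE x in ?M. x \<in> torus l" by (rule AE_I2) simp
  have ne: "AE x in ?M. \<forall>i. x $ i \<noteq> w $ i" for w
    by (intro AE_torusI) (simp add: AE_all_countable AE_coordinate_neq)
  show ?thesis
  proof (cases "\<exists>i. b' $ i \<le> a' $ i")
    case True
    then obtain i where i: "b' $ i \<le> a' $ i" ..
    have "AE x in ?M. indicator (box a b) x * h x = 0"
      using inT ne[of a']
    proof eventually_elim
      case (elim x)
      have "x \<notin> box a b"
        using elim i by (auto simp: mem_box_cart torus_iff a'_def b'_def) (smt (verit))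
      then show ?case by simp
    qed
    then show ?thesis by (rule integral_eq_zero_AE)
  next
    case False
    define c where "c = (1/2) *\<^sub>R (a' + b')"
    define \<rho> where "\<rho> = (1/2) *\<^sub>R (b' - a')"
    have ab: "a' $ i < b' $ i" for i using False by (simp add: not_le)
    have bnd: "- l \<le> a' $ i" "b' $ i \<le> l" for i by (auto simp: a'_def b'_def)
    have cr: "c $ i = (a' $ i + b' $ i) / 2" "\<rho> $ i = (b' $ i - a' $ i) / 2" for i
      by (auto simp: c_def \<rho>_def)
    have lim: "AE x in ?M. (\<lambda>n. h x * box_test l c \<rho> n x) \<longlonglongrightarrow> h x * indicator (box a b) x"
      using inT ne[of a'] ne[of b'] ne[of "\<chi> i. l"] ne[of "\<chi> i. - l"]
    proof eventually_elim
      case (elim x)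
      have xl: "- l < x $ i" "x $ i < l" for i
        using elim by (auto simp: torus_iff less_le)
      have "(\<lambda>n. box_test l c \<rho> n x) \<longlonglongrightarrow> indicator (box a b) x"
      proof (cases "x \<in> box a b")
        case True
        have "a' $ i < x $ i" "x $ i < b' $ i" for i
          using True xl[of i] by (auto simp: a'_def b'_def mem_box_cart)
        then have "\<bar>x $ i - c $ i\<bar> < \<rho> $ i" for i
          unfolding cr abs_less_iff by (auto simp: field_simps)
        moreover have "\<rho> $ i \<le> l" for i using bnd[of i] by (simp add: cr)
        ultimately show ?thesis using True box_test_tendsto_1[of x c \<rho> l] by simp
      next
        case False
        then obtain k where "\<not> (a $ k < x $ k \<and> x $ k < b $ k)"
          by (auto simp: mem_box_cart)
        then have k: "x $ k < a' $ k \<or> b' $ k < x $ k"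
          using elim(2,3)[rule_format, of k] xl[of k] unfolding a'_def b'_def by (simp, linarith)
        have "\<rho> $ k < \<bar>x $ k - c $ k\<bar>"
          using k ab[of k] bnd[of k] xl[of k] unfolding cr by argo
        moreover have "\<bar>x $ k - c $ k\<bar> < 2 * l - \<rho> $ k"
          using k ab[of k] bnd[of k] xl[of k] unfolding cr by argo
        moreover have "0 \<le> \<rho> $ k" using ab[of k] by (simp add: cr)
        ultimately show ?thesis using False box_test_tendsto_0[OF _ _ _ l] by simp
      qed
      then show ?case by (intro tendsto_intros)
    qed
    have mb: "box_test l c \<rho> n \<in> borel_measurable ?M" for n
      using smooth_box_test[of l c \<rho> n] Ck_imp_continuous
      by (intro measurable_torusI borel_measurable_continuous_onI) (auto simp: smooth_def)
    have "(\<lambda>n. \<integral>x. h x * box_test l c \<rho> n x \<partial>?M) \<longlonglongrightarrow> (\<integral>x. h x * indicator (box a b) x \<partial>?M)"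
    proof (rule integral_dominated_convergence[OF _ _ _ lim])
      show "(\<lambda>x. h x * indicator (box a b) x) \<in> borel_measurable ?M"
        by (intro borel_measurable_times hm measurable_torusI) measurable
      show "(\<lambda>x. h x * box_test l c \<rho> n x) \<in> borel_measurable ?M" for n
        by (intro borel_measurable_times hm mb)
      show "integrable ?M (\<lambda>x. \<bar>h x\<bar>)" using h by simp
      show "AE x in ?M. norm (h x * box_test l c \<rho> n x) \<le> \<bar>h x\<bar>" for n
        using box_test_bounds[of l c \<rho> n] by (auto simp: abs_mult intro!: mult_left_le)
    qed
    moreover have "(\<integral>x. h x * box_test l c \<rho> n x \<partial>?M) = 0" for n
      by (intro z smooth_box_test periodic_box_test l)
    ultimately have "(\<integral>x. h x * indicator (box a b) x \<partial>?M) = 0"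
      using LIMSEQ_unique[of "\<lambda>_. 0"] by auto
    then show ?thesis by (simp add: mult.commute)
  qed
qed

text \<open>The integrals over boxes determine those over Borel sets and over Lebesgue sets.\<close>

lemma AE_zero_of_test:
  fixes h :: "real ^ 'n \<Rightarrow> real"
  assumes l: "0 < l" and h: "integrable (torus_measure l) h"
    and z: "\<And>\<psi>. smooth \<psi> \<Longrightarrow> periodic l \<psi> \<Longrightarrow> (\<integral>x. h x * \<psi> x \<partial>torus_measure l) = 0"
  shows "AE x in torus_measure l. h x = 0"
proof -
  let ?M = "torus_measure l :: (real ^ 'n) measure"
  interpret finite_measure ?M by (rule finite_torus_measure)
  have hm [measurable]: "h \<in> borel_measurable ?M" using h by auto
  have int: "set_integrable ?M A h" if "A \<in> sets ?M" for A
    unfolding set_integrable_def by (rule integrable_mult_indicator[OF that h])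
  have sp: "space ?M = torus l" by (simp add: space_restrict_space)
  have inter: "(LINT x:A \<inter> torus l|?M. h x) = (LINT x:A|?M. h x)" for A
    unfolding set_lebesgue_integral_def
    by (rule Bochner_Integration.integral_cong) (auto simp: sp indicator_def)
  have b: "(LINT x:A|?M. h x) = 0" if "A \<in> sets borel" for A
  proof -
    have st: "Int_stable (range (\<lambda>(a, b). box a b :: (real ^ 'n) set))"
      by (auto simp: Int_stable_def box_Int_box)
    have A: "A \<in> sigma_sets UNIV (range (\<lambda>(a, b). box a b))"
      using that by (simp add: borel_eq_box)
    show ?thesis
    proof (rule sigma_sets_induct_disjoint[OF st _ A])
      show "range (\<lambda>(a, b). box a b :: (real ^ 'n) set) \<subseteq> Pow UNIV" by simp
      show "(LINT x:A|?M. h x) = 0" if "A \<in> range (\<lambda>(a, b). box a b)" for A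
        using that integral_box_zero[OF assms] by (auto simp: set_lebesgue_integral_def)
      show "(LINT x:{}|?M. h x) = 0" by (simp add: set_lebesgue_integral_def)
      show "(LINT x:UNIV - A|?M. h x) = 0"
        if "A \<in> sigma_sets UNIV (range (\<lambda>(a, b). box a b))" "(LINT x:A|?M. h x) = 0" for A
      proof -
        have A: "A \<inter> torus l \<in> sets ?M"
          using that(1) by (intro sets_torusI) (simp add: borel_eq_box)
        have "(LINT x:UNIV - A|?M. h x) = (LINT x|?M. h x - indicator (A \<inter> torus l) x *\<^sub>R h x)"
          unfolding set_lebesgue_integral_def
          by (rule Bochner_Integration.integral_cong) (auto simp: sp indicator_def)
        also have "\<dots> = (LINT x|?M. h x) - (LINT x:A \<inter> torus l|?M. h x)"
          unfolding set_lebesgue_integral_def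
          by (intro Bochner_Integration.integral_diff h integrable_mult_indicator[OF A])
        also have "(LINT x|?M. h x) = 0"
          using z[of "\<lambda>_. 1"] by (simp add: smooth_def Ck_const periodic_def)
        finally show ?thesis using that inter by simp
      qed
      show "(LINT x:\<Union> (range A)|?M. h x) = 0"
        if "disjoint_family A" "range A \<subseteq> sigma_sets UNIV (range (\<lambda>(a, b). box a b))"
          "\<And>i. (LINT x:A i|?M. h x) = 0" for A :: "nat \<Rightarrow> _"
      proof -
        have A: "A i \<inter> torus l \<in> sets ?M" for i
          using that(2) by (intro sets_torusI) (auto simp: borel_eq_box)
        have "(LINT x:\<Union> (range A)|?M. h x) = (LINT x:(\<Union>i. A i \<inter> torus l)|?M. h x)"
          by (subst inter[symmetric]) (simp add: Int_UN_distrib2)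
        also have "\<dots> = (\<Sum>i. LINT x:A i \<inter> torus l|?M. h x)"
          using that(1) by (intro lebesgue_integral_countable_add A int sets.countable_UN)
            (auto simp: disjoint_family_on_def A)
        finally show ?thesis using that(3) inter by simp
      qed
    qed
  qed
  have "(LINT x:A|?M. h x) = 0" if "A \<in> sets ?M" for A
  proof -
    from that have "A \<in> sets lebesgue" by (auto simp: sets_restrict_space)
    then obtain S N N' where A: "A = S \<union> N" "N \<subseteq> N'" "N' \<in> null_sets lborel" "S \<in> sets lborel"
      by (rule sets_completionE)
    have "AE x in lborel. x \<notin> N'" using A(3) by (rule AE_not_in)
    then have "AE x in ?M. x \<notin> N'" by (rule AE_torusI)
    then have "AE x in ?M. indicator A x *\<^sub>R h x = indicator S x *\<^sub>R h x"
      by eventually_elim (use A in \<open>auto simp: indicator_def\<close>)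
    then have "(LINT x:A|?M. h x) = (LINT x:S|?M. h x)"
      unfolding set_lebesgue_integral_def
    proof (rule integral_cong_AE[rotated 2])
      show "(\<lambda>x. indicator A x *\<^sub>R h x) \<in> borel_measurable ?M"
        using that by measurable
      have "indicat_real S \<in> borel_measurable ?M"
        using A(4) by (intro measurable_torusI) auto
      then show "(\<lambda>x. indicator S x *\<^sub>R h x) \<in> borel_measurable ?M" by measurable
    qed
    also have "\<dots> = 0" using A(4) by (intro b) simp
    finally show "(LINT x:A|?M. h x) = 0" .
  qed
  then show ?thesis by (rule density_zero[OF h])
qed

lemma weak_gradient_unique:
  fixes u :: "real ^ 'n \<Rightarrow> real"
  assumes l: "0 < l" and g: "is_weak_gradient l u g" and g': "is_weak_gradient l u g'"
  shows "AE x in torus_measure l. g x = g' x"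
proof -
  let ?M = "torus_measure l :: (real ^ 'n) measure"
  interpret finite_measure ?M by (rule finite_torus_measure)
  have int: "integrable ?M (\<lambda>x. g x $ i * \<psi> x)"
    if g: "is_weak_gradient l u g" and \<psi>: "smooth \<psi>" "periodic l \<psi>" for g i \<psi>
  proof -
    have c: "continuous_on UNIV \<psi>" using \<psi>(1) Ck_imp_continuous by (auto simp: smooth_def)
    obtain K where K: "\<And>x. \<bar>\<psi> x\<bar> \<le> K" "0 \<le> K"
      using periodic_bounded[OF l \<psi>(2) c] by blast
    have gm [measurable]: "g \<in> borel_measurable ?M" using g by (simp add: is_weak_gradient_def)
    have [measurable]: "\<psi> \<in> borel_measurable ?M"
      by (intro measurable_torusI borel_measurable_continuous_onI c)
    have [measurable]: "(\<lambda>x. g x $ i) \<in> borel_measurable ?M"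
      using measurable_compose[OF gm borel_measurable_continuous_onI, of "\<lambda>v. v $ i"]
      by (simp add: continuous_on_component continuous_on_id)
    show ?thesis
    proof (rule Bochner_Integration.integrable_bound)
      show "integrable ?M (\<lambda>x. (1 + (norm (g x))\<^sup>2) * K)"
        using g by (intro integrable_mult_left Bochner_Integration.integrable_add)
          (auto simp: is_weak_gradient_def)
      show "AE x in ?M. norm (g x $ i * \<psi> x) \<le> norm ((1 + (norm (g x))\<^sup>2) * K)"
      proof (rule always_eventually, rule allI)
        fix x
        have "\<bar>g x $ i\<bar> \<le> norm (g x)" by (rule component_le_norm_cart)
        also have "norm (g x) \<le> 1 + (norm (g x))\<^sup>2"
          using zero_le_power2[of "norm (g x) - 1"] by (simp add: power2_eq_square algebra_simps)
            (smt (verit) zero_le_square)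
        finally show "norm (g x $ i * \<psi> x) \<le> norm ((1 + (norm (g x))\<^sup>2) * K)"
          using K by (simp add: abs_mult mult_mono)
      qed
    qed measurable
  qed
  have "AE x in ?M. g x $ i - g' x $ i = 0" for i
  proof (rule AE_zero_of_test[OF l])
    have one: "smooth (\<lambda>_ :: real ^ 'n. 1)" "periodic l (\<lambda>_ :: real ^ 'n. 1 :: real)"
      by (auto simp: smooth_def Ck_const periodic_def)
    show "integrable ?M (\<lambda>x. g x $ i - g' x $ i)"
      using int[OF g one, of i] int[OF g' one, of i] by simp
    fix \<psi> :: "real ^ 'n \<Rightarrow> real" assume \<psi>: "smooth \<psi>" "periodic l \<psi>"
    have "(\<integral>x. (g x $ i - g' x $ i) * \<psi> x \<partial>?M)
        = (\<integral>x. g x $ i * \<psi> x \<partial>?M) - (\<integral>x. g' x $ i * \<psi> x \<partial>?M)"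
      using int[OF g \<psi>, of i] int[OF g' \<psi>, of i] by (simp add: left_diff_distrib)
    also have "\<dots> = 0"
    proof -
      have "(\<integral>x. u x * partial i \<psi> x \<partial>?M) = - (\<integral>x. g x $ i * \<psi> x \<partial>?M)"
        "(\<integral>x. u x * partial i \<psi> x \<partial>?M) = - (\<integral>x. g' x $ i * \<psi> x \<partial>?M)"
        using g g' \<psi> unfolding is_weak_gradient_def by blast+
      then show ?thesis by simp
    qed
    finally show "(\<integral>x. (g x $ i - g' x $ i) * \<psi> x \<partial>?M) = 0" .
  qed
  then have "AE x in ?M. \<forall>i. g x $ i - g' x $ i = 0" by (simp add: AE_all_countable)
  then show ?thesis by eventually_elim (simp add: vec_eq_iff)
qed

section \<open>Weak gradients from symmetric difference quotients\<close>

lemma Ck_lipschitz_line: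
  fixes f :: "real ^ 'n \<Rightarrow> real"
  assumes "Ck (Suc k) f" "\<And>x. \<bar>partial j f x\<bar> \<le> M"
  shows "\<bar>f (x + axis j s) - f (x + axis j t)\<bar> \<le> M * \<bar>s - t\<bar>"
  using field_differentiable_bound[of UNIV "\<lambda>s. f (x + axis j s)" "\<lambda>s. partial j f (x + axis j s)" M s t]
    Ck1_has_derivative_line[OF assms(1), of x j] assms(2)
  by simp

lemma add_axis_0 [simp]: "x + axis j (0::real) = x"
  by (simp add: vec_eq_iff axis_def)

lemma periodic_partial:
  fixes f :: "real ^ 'n \<Rightarrow> real"
  assumes "Ck (Suc k) f" "periodic l f"
  shows "periodic l (partial j f)"
  unfolding periodic_def
proof (intro allI)
  fix x i
  have e: "f (x + axis i (2 * l) + axis j s) = f (x + axis j s)" for s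
    using assms(2)[unfolded periodic_def, rule_format, of "x + axis j s" i] by (simp add: ac_simps)
  show "partial j f (x + axis i (2 * l)) = partial j f x"
    by (rule partial_unique[OF assms(1)])
      (use Ck1_has_derivative_line[OF assms(1), of x j 0] in \<open>simp add: e\<close>)
qed

lemma Ck_reflect:
  fixes f :: "real ^ 'n \<Rightarrow> real"
  shows "Ck k f \<Longrightarrow> Ck k (\<lambda>x. f (reflect a i x))"
proof (induction k arbitrary: f)
  case 0
  then show ?case
    using continuous_on_compose2[of UNIV f UNIV "reflect a i"]
      continuous_on_reflect[OF continuous_on_id] by auto
next
  case (Suc k)
  obtain D where D: "\<And>x. (f has_derivative D x) (at x)" "\<And>b. b \<in> Basis \<Longrightarrow> Ck k (\<lambda>x. D x b)"
    using Ck_SucE[OF Suc.prems] by blast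
  have "(reflect a i has_derivative reflect 0 i) (at x)" for x
  proof -
    have "reflect a i = (\<lambda>x. reflect 0 i x + axis i (2 * a))"
      by (auto simp: fun_eq_iff vec_eq_iff reflect_nth axis_nth_eq)
    moreover have "bounded_linear (reflect 0 i :: real ^ 'n \<Rightarrow> real ^ 'n)"
      by (intro linear_conv_bounded_linear[THEN iffD1] linearI)
        (auto simp: vec_eq_iff reflect_nth algebra_simps)
    ultimately show ?thesis
      by (auto intro!: derivative_eq_intros bounded_linear_imp_has_derivative)
  qed
  then have d: "((\<lambda>x. f (reflect a i x)) has_derivative (\<lambda>h. D (reflect a i x) (reflect 0 i h))) (at x)" for x
    by (rule has_derivative_compose[OF _ D(1)])
  show ?case
  proof (rule Ck_SucI[OF d])
    fix b :: "real ^ 'n" assume b: "b \<in> Basis"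
    then obtain j where j: "b = axis j 1" by (auto simp: Basis_vec_def)
    have r: "reflect 0 i b = (if j = i then -1 else 1) *\<^sub>R b"
      by (auto simp: j vec_eq_iff reflect_nth axis_nth_eq)
    have "(\<lambda>x. D (reflect a i x) (reflect 0 i b)) = (\<lambda>x. (if j = i then -1 else 1) * D (reflect a i x) b)"
      unfolding r using linear_scale[OF has_derivative_linear[OF D(1)]] by (metis real_scaleR_def)
    then show "Ck k (\<lambda>x. D (reflect a i x) (reflect 0 i b))"
      by (simp only:) (intro Ck_cmult Suc.IH D(2) b)
  qed
qed

lemma partial_reflect:
  fixes f :: "real ^ 'n \<Rightarrow> real"
  assumes "Ck (Suc k) f"
  shows "partial j (\<lambda>x. f (reflect a i x)) x = (if j = i then -1 else 1) * partial j f (reflect a i x)"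
proof (rule partial_unique[OF Ck_reflect[OF assms]])
  let ?e = "(if j = i then -1 else 1) :: real"
  have e: "reflect a i (x + axis j s) = reflect a i x + axis j (?e * s)" for s
    by (auto simp: reflect_add_axis)
  show "((\<lambda>s. f (reflect a i (x + axis j s))) has_real_derivative ?e * partial j f (reflect a i x)) (at 0)"
    unfolding e
    using DERIV_chain2[where f = "\<lambda>s. f (reflect a i x + axis j s)" and g = "\<lambda>s. ?e * s" and x = 0
        and s = UNIV, OF Ck1_has_derivative_line[OF assms] DERIV_cmult_Id[of ?e]]
    by (simp add: mult.commute)
qed

lemma filterlim_uminus_at_0: "filterlim uminus (at (0::real)) (at 0)"
  by (auto simp: filterlim_at intro!: tendsto_eq_intros eventually_at_filter[THEN iffD2])

lemma symmetric_derivative: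
  fixes w :: "real \<Rightarrow> real"
  assumes "(w has_real_derivative d) (at 0)"
  shows "((\<lambda>h. (w h - w (- h)) / (2 * h)) \<longlongrightarrow> d) (at 0)"
proof -
  have p: "((\<lambda>s. (w s - w 0) / s) \<longlongrightarrow> d) (at 0)"
    using assms by (simp add: has_field_derivative_iff)
  have n: "((\<lambda>s. (w (- s) - w 0) / (- s)) \<longlongrightarrow> d) (at 0)"
    using filterlim_compose[OF p filterlim_uminus_at_0] .
  have "((\<lambda>s. 1 / 2 * ((w s - w 0) / s + (w (- s) - w 0) / (- s))) \<longlongrightarrow> d) (at 0)"
    using tendsto_mult_left[OF tendsto_add[OF p n], of "1/2"] by simp
  then show ?thesis
    by (rule Lim_transform_eventually) (auto simp: eventually_at_filter field_simps)
qed

lemma eventually_sgn_eq: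
  fixes f :: "real \<Rightarrow> real"
  assumes "(f \<longlongrightarrow> c) F" "c \<noteq> 0"
  shows "\<forall>\<^sub>F h in F. sgn (f h) = sgn c"
proof (cases "0 < c")
  case True
  then show ?thesis using order_tendstoD(1)[OF assms(1) True] by (auto elim: eventually_mono)
next
  case False
  then have "c < 0" using assms(2) by simp
  then show ?thesis using order_tendstoD(2)[OF assms(1) \<open>c < 0\<close>] by (auto elim!: eventually_mono)
qed

text \<open>
  The integral of a symmetric difference quotient of the periodic function \<open>F \<psi>\<close> vanishes by
  translation invariance, and the quotients converge to \<open>F \<partial>\<^sub>j\<psi> + g \<psi>\<close> boundedly.
\<close>

lemma weak_partial_of_symmetric_derivative:
  fixes F \<psi> :: "real ^ 'n \<Rightarrow> real"
  assumes l: "0 < l" and F: "continuous_on UNIV F" "periodic l F"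
    and lip: "\<And>x h. \<bar>F (x + axis j h) - F x\<bar> \<le> C * \<bar>h\<bar>"
    and g: "g \<in> borel_measurable borel"
    and lim: "AE x in lborel. ((\<lambda>h. (F (x + axis j h) - F (x + axis j (- h))) / (2 * h)) \<longlongrightarrow> g x) (at 0)"
    and g_bd: "\<And>x. \<bar>g x\<bar> \<le> K"
    and \<psi>: "Ck (Suc k) \<psi>" "periodic l \<psi>"
  shows "(\<integral>x. F x * partial j \<psi> x \<partial>torus_measure l) = - (\<integral>x. g x * \<psi> x \<partial>torus_measure l)"
proof -
  let ?M = "torus_measure l :: (real ^ 'n) measure"
  have cont: "continuous_on UNIV \<psi>" "continuous_on UNIV (partial j \<psi>)"
    using Ck_imp_continuous[OF \<psi>(1)] Ck_continuous_partial[OF \<psi>(1)] by auto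
  have meas [measurable]: "F \<in> borel_measurable borel" "\<psi> \<in> borel_measurable borel"
     "partial j \<psi> \<in> borel_measurable borel" "g \<in> borel_measurable borel"
    using F cont g by (auto intro: borel_measurable_continuous_onI)
  obtain A where A: "\<And>x. \<bar>F x\<bar> \<le> A" "0 \<le> A" using periodic_bounded[OF l F(2,1)] by blast
  obtain B where B: "\<And>x. \<bar>\<psi> x\<bar> \<le> B" "0 \<le> B" using periodic_bounded[OF l \<psi>(2) cont(1)] by blast
  obtain P where P: "\<And>x. \<bar>partial j \<psi> x\<bar> \<le> P" "0 \<le> P"
    using periodic_bounded[OF l periodic_partial[OF \<psi>] cont(2)] by blast
  have C0: "0 \<le> C" using lip[of 0 1] by simp
  have K0: "0 \<le> K" using g_bd[of 0] by linarith
  define E where "E x = F x * \<psi> x" for x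
  have [measurable]: "E \<in> borel_measurable borel" unfolding E_def by measurable
  have Ebd: "\<bar>E x\<bar> \<le> A * B" for x using A B by (simp add: E_def abs_mult mult_mono)
  have Eper: "periodic l E" using F \<psi> by (simp add: periodic_def E_def)
  define h where "h n = 1 / real (Suc n)" for n
  have h0: "0 < h n" for n by (simp add: h_def)
  have hlim: "filterlim h (at 0) sequentially"
  proof -
    have "h = (\<lambda>n. inverse (real (Suc n)))" by (simp add: h_def fun_eq_iff inverse_eq_divide)
    then show ?thesis
      unfolding filterlim_at using h0 LIMSEQ_inverse_real_of_nat
      by (auto simp: less_imp_neq[THEN not_sym])
  qed
  define D where "D n x = (E (x + axis j (h n)) - E (x + axis j (- h n))) / (2 * h n)" for n x
  have [measurable]: "D n \<in> borel_measurable borel" for n unfolding D_def by measurable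
  have D0: "(\<integral>x. D n x \<partial>?M) = 0" for n
  proof -
    have "integrable ?M (\<lambda>x. E (x + axis j s))" for s
      by (rule integrable_torus[of _ "A * B"]) (use Ebd in \<open>auto intro: measurable_compose[OF _ \<open>E \<in> borel_measurable borel\<close>]\<close>)
    then show ?thesis
      using integral_torus_shift[OF l _ Ebd Eper] by (simp add: D_def)
  qed
  have "AE x in ?M. (\<lambda>n. D n x) \<longlonglongrightarrow> F x * partial j \<psi> x + g x * \<psi> x"
    using AE_torusI[OF lim]
  proof eventually_elim
    case (elim x)
    have a: "(\<lambda>h. (\<psi> (x + axis j h) - \<psi> (x + axis j (- h))) / (2 * h)) \<midarrow>0\<rightarrow> partial j \<psi> x"
      using symmetric_derivative[OF Ck1_has_derivative_line[OF \<psi>(1), of x j 0]] by simp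
    have c1: "(\<lambda>h. F (x + axis j h)) \<midarrow>0\<rightarrow> F x"
    proof (rule Lim_null_comparison[of "\<lambda>h. F (x + axis j h) - F x" "\<lambda>h. C * \<bar>h\<bar>", THEN LIM_zero_cancel])
      show "\<forall>\<^sub>F h in at 0. norm (F (x + axis j h) - F x) \<le> C * \<bar>h\<bar>" using lip by simp
      show "(\<lambda>h. C * \<bar>h\<bar>) \<midarrow>0\<rightarrow> 0" by (auto intro!: tendsto_eq_intros)
    qed
    have c2: "(\<lambda>h. \<psi> (x + axis j (- h))) \<midarrow>0\<rightarrow> \<psi> x"
    proof (rule Lim_null_comparison[of "\<lambda>h. \<psi> (x + axis j (- h)) - \<psi> x" "\<lambda>h. P * \<bar>h\<bar>", THEN LIM_zero_cancel])
      show "\<forall>\<^sub>F h in at 0. norm (\<psi> (x + axis j (- h)) - \<psi> x) \<le> P * \<bar>h\<bar>"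
        using Ck_lipschitz_line[OF \<psi>(1) P(1), of x "- _" 0] by simp
      show "(\<lambda>h. P * \<bar>h\<bar>) \<midarrow>0\<rightarrow> 0" by (auto intro!: tendsto_eq_intros)
    qed
    have "((\<lambda>h. F (x + axis j h) * ((\<psi> (x + axis j h) - \<psi> (x + axis j (- h))) / (2 * h))
        + (F (x + axis j h) - F (x + axis j (- h))) / (2 * h) * \<psi> (x + axis j (- h)))
        \<longlongrightarrow> F x * partial j \<psi> x + g x * \<psi> x) (at 0)"
      by (intro tendsto_add tendsto_mult c1 c2 a elim)
    then have "((\<lambda>h. (E (x + axis j h) - E (x + axis j (- h))) / (2 * h))
        \<longlongrightarrow> F x * partial j \<psi> x + g x * \<psi> x) (at 0)"
      by (rule Lim_transform_eventually) (auto simp: E_def eventually_at_filter field_simps)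
    from filterlim_compose[OF this hlim] show ?case by (simp add: D_def)
  qed
  then have "(\<lambda>n. \<integral>x. D n x \<partial>?M) \<longlonglongrightarrow> (\<integral>x. F x * partial j \<psi> x + g x * \<psi> x \<partial>?M)"
  proof (rule integral_dominated_convergence[rotated 3])
    show "integrable ?M (\<lambda>x. A * P + C * B)"
      by (rule integrable_torus) auto
    show "(\<lambda>x. F x * partial j \<psi> x + g x * \<psi> x) \<in> borel_measurable ?M"
      by (intro measurable_torusI) measurable
    show "D n \<in> borel_measurable ?M" for n by (intro measurable_torusI) measurable
    show "AE x in ?M. norm (D n x) \<le> A * P + C * B" for n
    proof (rule always_eventually, rule allI)
      fix x
      let ?p = "x + axis j (h n)" and ?m = "x + axis j (- h n)"
      have "\<bar>\<psi> ?p - \<psi> ?m\<bar> \<le> P * (2 * h n)"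
        using Ck_lipschitz_line[OF \<psi>(1) P(1), of x "h n" "- h n"] h0[of n] by simp
      moreover have "\<bar>F ?p - F ?m\<bar> \<le> C * (2 * h n)"
      proof -
        have "?m + axis j (2 * h n) = ?p" by (simp add: vec_eq_iff axis_def)
        then show ?thesis
          using lip[of ?m "2 * h n"] h0[of n] by (simp only: abs_of_pos mult_pos_pos zero_less_numeral)
      qed
      moreover have "E ?p - E ?m = F ?p * (\<psi> ?p - \<psi> ?m) + (F ?p - F ?m) * \<psi> ?m"
        by (simp add: E_def algebra_simps)
      ultimately have "\<bar>E ?p - E ?m\<bar> \<le> A * (P * (2 * h n)) + C * (2 * h n) * B"
        using A B P C0 h0[of n]
        by (simp only:) (intro order_trans[OF abs_triangle_ineq] add_mono; simp add: abs_mult mult_mono)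
      also have "\<dots> = (A * P + C * B) * (2 * h n)" by (simp add: algebra_simps)
      finally show "norm (D n x) \<le> A * P + C * B"
        using h0[of n] by (simp add: D_def divide_le_eq)
    qed
  qed
  then have z: "(\<integral>x. F x * partial j \<psi> x + g x * \<psi> x \<partial>?M) = 0"
    by (simp add: D0 LIMSEQ_const_iff)
  have i1: "integrable ?M (\<lambda>x. F x * partial j \<psi> x)"
    by (rule integrable_torus[of _ "A * P"]) (use A P in \<open>auto simp: abs_mult mult_mono\<close>)
  have i2: "integrable ?M (\<lambda>x. g x * \<psi> x)"
    by (rule integrable_torus[of _ "K * B"]) (use K0 g_bd B in \<open>auto simp: abs_mult mult_mono\<close>)
  show ?thesis
    using z Bochner_Integration.integral_add[OF i1 i2] by simp
qed

lemma is_weak_gradientI: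
  fixes F :: "real ^ 'n \<Rightarrow> real" and g :: "real ^ 'n \<Rightarrow> real ^ 'n"
  assumes l: "0 < l" and F: "continuous_on UNIV F" "periodic l F"
    and lip: "\<And>j x h. \<bar>F (x + axis j h) - F x\<bar> \<le> C * \<bar>h\<bar>"
    and g: "g \<in> borel_measurable borel"
    and lim: "\<And>j. AE x in lborel. ((\<lambda>h. (F (x + axis j h) - F (x + axis j (- h))) / (2 * h)) \<longlongrightarrow> g x $ j) (at 0)"
    and g_bd: "\<And>x. norm (g x) \<le> K"
  shows "is_weak_gradient l F g"
  unfolding is_weak_gradient_def
proof (intro conjI allI impI)
  show "g \<in> borel_measurable (torus_measure l)"
    using g by (intro measurable_restrict_space1 measurable_completion) simp
  have "(norm (g x))\<^sup>2 \<le> K\<^sup>2" for x using g_bd by (simp add: power_mono)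
  then show "integrable (torus_measure l) (\<lambda>x. (norm (g x))\<^sup>2)"
    by (intro integrable_torus[of _ "K\<^sup>2"]) (use g in auto)
  fix \<psi> :: "real ^ 'n \<Rightarrow> real" and i assume \<psi>: "smooth \<psi>" "periodic l \<psi>"
  have gi: "(\<lambda>x. g x $ i) \<in> borel_measurable borel"
    using measurable_compose[OF g borel_measurable_continuous_onI, of "\<lambda>v. v $ i"]
    by (simp add: continuous_on_component continuous_on_id)
  show "(\<integral>x. F x * partial i \<psi> x \<partial>torus_measure l) = - (\<integral>x. g x $ i * \<psi> x \<partial>torus_measure l)"
    by (rule weak_partial_of_symmetric_derivative[OF l F lip gi lim _ _ \<psi>(2), of K 0])
      (use \<psi>(1) order_trans[OF component_le_norm_cart g_bd] in \<open>auto simp: smooth_def\<close>)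
qed

section \<open>Polarization\<close>

text \<open>The classical gradient.\<close>

definition grad :: "(real ^ 'n \<Rightarrow> real) \<Rightarrow> real ^ 'n \<Rightarrow> real ^ 'n" where
  "grad u x = (\<chi> j. partial j u x)"

lemma continuous_on_grad: "Ck (Suc k) u \<Longrightarrow> continuous_on UNIV (grad u)"
  unfolding grad_def by (intro continuous_on_vec_lambda Ck_continuous_partial)

lemma periodic_grad: "Ck (Suc k) u \<Longrightarrow> periodic l u \<Longrightarrow> periodic l (grad u)"
  using periodic_partial[of k u l] by (simp add: periodic_def grad_def)

lemma norm_grad_reflect:
  assumes "Ck (Suc k) u"
  shows "norm (grad (\<lambda>x. u (reflect a i x)) x) = norm (grad u (reflect a i x))"
  unfolding norm_vec_def L2_set_def grad_def vec_lambda_beta partial_reflect[OF assms]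
  by (intro arg_cong[of _ _ sqrt] sum.cong) auto

text \<open>Positive on \<open>a < x\<^sub>i < a + l\<close> and its translates by \<open>2l\<close>, negative on the complementary open slabs.\<close>

definition half_sign :: "real \<Rightarrow> real \<Rightarrow> 'n \<Rightarrow> real ^ 'n \<Rightarrow> real" where
  "half_sign l a i x = sin (pi / l * (x $ i - a))"

text \<open>The difference \<open>w\<close> of \<open>u\<close> and its reflection.\<close>

definition refl_diff :: "real \<Rightarrow> 'n \<Rightarrow> (real ^ 'n \<Rightarrow> real) \<Rightarrow> real ^ 'n \<Rightarrow> real" where
  "refl_diff a i u x = u x - u (reflect a i x)"

text \<open>
  For periodic \<open>u\<close> this is \<open>0\<close> where \<open>u\<close> and its reflection agree; elsewhere it is \<open>1\<close> where
  polarization keeps \<open>u\<close> and \<open>-1\<close> where it takes the reflection of \<open>u\<close>.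
\<close>

definition polar_sign :: "real \<Rightarrow> real \<Rightarrow> 'n \<Rightarrow> (real ^ 'n \<Rightarrow> real) \<Rightarrow> real ^ 'n \<Rightarrow> real" where
  "polar_sign l a i u x = sgn (half_sign l a i x * refl_diff a i u x)"

text \<open>
  The polarization of \<open>u\<close> with respect to the reflection \<open>x\<^sub>i \<mapsto> 2a - x\<^sub>i\<close> is the larger of \<open>u\<close> and its
  reflection where \<open>sin (\<pi> (x\<^sub>i - a) / l) > 0\<close>, which is the periodic extension of \<open>a < x\<^sub>i < a + l\<close>,
  and the smaller one elsewhere. Since \<^const>\<open>polar_sign\<close> is invariant under the reflection, polarization only
  interchanges values within the pairs of mutually reflected points.
\<close>

definition polarize :: "real \<Rightarrow> real \<Rightarrow> 'n \<Rightarrow> (real ^ 'n \<Rightarrow> real) \<Rightarrow> real ^ 'n \<Rightarrow> real" where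
  "polarize l a i u x = (if 0 \<le> polar_sign l a i u x then u x else u (reflect a i x))"

lemma half_sign_reflect: "half_sign l a i (reflect a i x) = - half_sign l a i x"
proof -
  have "pi / l * (2 * a - x $ i - a) = - (pi / l * (x $ i - a))" by (simp add: algebra_simps)
  then show ?thesis by (simp only: half_sign_def reflect_nth if_True simp_thms sin_minus)
qed

lemma refl_diff_reflect: "refl_diff a i u (reflect a i x) = - refl_diff a i u x"
  by (simp add: refl_diff_def)

lemma polar_sign_reflect: "polar_sign l a i u (reflect a i x) = polar_sign l a i u x"
  by (simp add: polar_sign_def half_sign_reflect refl_diff_reflect)

lemma polarize_reflect:
  "polarize l a i u (reflect a i x) = (if 0 \<le> polar_sign l a i u x then u (reflect a i x) else u x)"
  by (simp add: polarize_def polar_sign_reflect)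

lemma continuous_on_half_sign: "continuous_on UNIV (half_sign l a i)"
  unfolding half_sign_def by (intro continuous_intros)

lemma periodic_half_sign:
  fixes i :: "'n::finite"
  assumes "0 < l"
  shows "periodic l (half_sign l a i)"
  unfolding periodic_def
proof (intro allI)
  fix x :: "real ^ 'n" and j
  have "pi / l * (y + 2 * l - a) = pi / l * (y - a) + 2 * pi" for y
    using assms by (simp add: field_simps)
  then have "sin (pi / l * (y + 2 * l - a)) = sin (pi / l * (y - a))" for y
    by (simp only: sin_periodic)
  then show "half_sign l a i (x + axis j (2 * l)) = half_sign l a i x"
    by (cases "j = i") (simp_all add: half_sign_def axis_nth_eq)
qed

lemma half_sign_eq_0_iff:
  assumes "0 < l"
  shows "half_sign l a i x = 0 \<longleftrightarrow> (\<exists>k::int. x $ i = a + l * of_int k)"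
proof -
  have "half_sign l a i x = 0 \<longleftrightarrow> (\<exists>k::int. pi / l * (x $ i - a) = of_int k * pi)"
    by (auto simp: half_sign_def sin_zero_iff_int2)
  also have "\<dots> \<longleftrightarrow> (\<exists>k::int. x $ i = a + l * of_int k)"
  proof -
    have "pi / l * (x $ i - a) = of_int k * pi \<longleftrightarrow> x $ i = a + l * of_int k" for k
    proof -
      have "pi / l * (x $ i - a) = of_int k * pi \<longleftrightarrow> pi * ((x $ i - a) / l) = pi * of_int k"
        by (simp add: mult.commute)
      also have "\<dots> \<longleftrightarrow> (x $ i - a) / l = of_int k"
        by (subst mult_cancel_left) simp
      finally show ?thesis using assms by (auto simp: field_simps)
    qed
    then show ?thesis by simp
  qed
  finally show ?thesis .
qed

lemma half_sign_pos: "0 < l \<Longrightarrow> a < x $ i \<Longrightarrow> x $ i < a + l \<Longrightarrow> 0 < half_sign l a i x"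
proof -
  assume x: "0 < l" "a < x $ i" "x $ i < a + l"
  have "pi * ((x $ i - a) / l) < pi * 1"
    using x by (intro mult_strict_left_mono) auto
  then show ?thesis
    unfolding half_sign_def using x by (intro sin_gt_zero) auto
qed

lemma AE_half_sign_neq_0: "0 < l \<Longrightarrow> AE x in lborel. half_sign l a i x \<noteq> 0"
  by (simp add: half_sign_eq_0_iff AE_all_countable AE_coordinate_neq)

lemma refl_diff_eq_0:
  assumes "0 < l" "periodic l u" "half_sign l a i x = 0"
  shows "refl_diff a i u x = 0"
proof -
  obtain k :: int where k: "x $ i = a + l * of_int k"
    using assms half_sign_eq_0_iff by blast
  have "reflect a i x = x + axis i (2 * l * of_int (- k))"
    by (simp add: reflect_eq k algebra_simps)
  then show ?thesis
    using periodic_axis_int[OF assms(2)] by (simp add: refl_diff_def del: of_int_minus)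
qed

lemma signed_abs_lipschitz:
  fixes \<sigma> w :: "real \<Rightarrow> real"
  assumes \<sigma>: "continuous_on UNIV \<sigma>" and w: "\<And>s t. \<bar>w s - w t\<bar> \<le> C * \<bar>s - t\<bar>"
    and z: "\<And>t. \<sigma> t = 0 \<Longrightarrow> w t = 0"
  shows "\<bar>sgn (\<sigma> s) * \<bar>w s\<bar> - sgn (\<sigma> t) * \<bar>w t\<bar>\<bar> \<le> C * \<bar>s - t\<bar>"
proof (induction s t rule: linorder_wlog)
  case (le s t)
  show ?case
  proof (cases "sgn (\<sigma> s) = sgn (\<sigma> t)")
    case True
    then have "\<bar>sgn (\<sigma> s) * \<bar>w s\<bar> - sgn (\<sigma> t) * \<bar>w t\<bar>\<bar> = \<bar>sgn (\<sigma> t)\<bar> * \<bar>\<bar>w s\<bar> - \<bar>w t\<bar>\<bar>"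
      by (simp add: right_diff_distrib[symmetric] abs_mult)
    also have "\<dots> \<le> 1 * \<bar>w s - w t\<bar>"
      by (intro mult_mono abs_triangle_ineq3) (auto simp: abs_sgn_eq)
    finally have "\<bar>sgn (\<sigma> s) * \<bar>w s\<bar> - sgn (\<sigma> t) * \<bar>w t\<bar>\<bar> \<le> \<bar>w s - w t\<bar>" by simp
    then show ?thesis using w[of s t] by linarith
  next
    case False
    \<comment> \<open>the signs differ, so \<open>\<sigma>\<close> and hence \<open>w\<close> vanish in between\<close>
    have "\<sigma> s \<le> 0 \<and> 0 \<le> \<sigma> t \<or> \<sigma> t \<le> 0 \<and> 0 \<le> \<sigma> s"
      using False by (auto simp: sgn_real_def split: if_splits)
    then obtain r where r: "s \<le> r" "r \<le> t" "\<sigma> r = 0"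
      using IVT'[of \<sigma> s 0 t] IVT2'[of \<sigma> t 0 s] le continuous_on_subset[OF \<sigma>, of "{s..t}"] by auto
    have "\<bar>sgn (\<sigma> s) * \<bar>w s\<bar> - sgn (\<sigma> t) * \<bar>w t\<bar>\<bar> \<le> \<bar>sgn (\<sigma> s)\<bar> * \<bar>w s\<bar> + \<bar>sgn (\<sigma> t)\<bar> * \<bar>w t\<bar>"
      by (rule order_trans[OF abs_triangle_ineq4]) (simp add: abs_mult)
    also have "\<dots> \<le> 1 * \<bar>w s\<bar> + 1 * \<bar>w t\<bar>"
      by (intro add_mono mult_right_mono) (auto simp: abs_sgn_eq)
    also have "\<dots> = \<bar>w s - w r\<bar> + \<bar>w r - w t\<bar>"
      using z[OF r(3)] by simp
    also have "\<dots> \<le> C * (r - s) + C * (t - r)"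
      using w[of s r] w[of r t] r by (intro add_mono) auto
    finally show ?thesis using r by (simp add: algebra_simps)
  qed
next
  case (sym s t)
  then show ?case by (simp add: abs_minus_commute)
qed

lemma abs_symmetric_derivative:
  fixes w :: "real \<Rightarrow> real"
  assumes d: "(w has_real_derivative d) (at 0)"
  shows "((\<lambda>h. (\<bar>w h\<bar> - \<bar>w (- h)\<bar>) / (2 * h)) \<longlongrightarrow> sgn (w 0) * d) (at 0)"
proof -
  have p: "((\<lambda>s. (w s - w 0) / s) \<longlongrightarrow> d) (at 0)"
    using d by (simp add: has_field_derivative_iff)
  have n: "((\<lambda>s. (w (- s) - w 0) / (- s)) \<longlongrightarrow> d) (at 0)"
    using filterlim_compose[OF p filterlim_uminus_at_0] .
  show ?thesis
  proof (cases "w 0 = 0")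
    case True
    have "((\<lambda>h. 1 / 2 * sgn h * (\<bar>(w h - w 0) / h\<bar> - \<bar>(w (- h) - w 0) / (- h)\<bar>)) \<longlongrightarrow> 0) (at 0)"
    proof (rule Lim_null_comparison)
      show "((\<lambda>h. \<bar>\<bar>(w h - w 0) / h\<bar> - \<bar>(w (- h) - w 0) / (- h)\<bar>\<bar>) \<longlongrightarrow> 0) (at 0)"
        using tendsto_rabs[OF tendsto_diff[OF tendsto_rabs[OF p] tendsto_rabs[OF n]]] by simp
      show "\<forall>\<^sub>F h in at 0. norm (1 / 2 * sgn h * (\<bar>(w h - w 0) / h\<bar> - \<bar>(w (- h) - w 0) / (- h)\<bar>))
          \<le> \<bar>\<bar>(w h - w 0) / h\<bar> - \<bar>(w (- h) - w 0) / (- h)\<bar>\<bar>"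
        by (rule always_eventually) (auto simp: abs_mult sgn_real_def)
    qed
    then have "((\<lambda>h. (\<bar>w h\<bar> - \<bar>w (- h)\<bar>) / (2 * h)) \<longlongrightarrow> 0) (at 0)"
      by (rule Lim_transform_eventually)
        (auto simp: eventually_at_filter True abs_divide sgn_if diff_divide_distrib)
    then show ?thesis by (simp add: True)
  next
    case False
    have "isCont w 0" using d by (rule DERIV_isCont)
    then have c: "(w \<longlongrightarrow> w 0) (at 0)" by (simp add: isCont_def)
    have c': "((\<lambda>h. w (- h)) \<longlongrightarrow> w 0) (at 0)" using filterlim_compose[OF c filterlim_uminus_at_0] .
    have t: "((\<lambda>h. sgn (w 0) * ((w h - w (- h)) / (2 * h))) \<longlongrightarrow> sgn (w 0) * d) (at 0)"
      by (intro tendsto_mult_left symmetric_derivative d)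
    show ?thesis
    proof (rule Lim_transform_eventually[OF t])
      show "\<forall>\<^sub>F h in at 0. sgn (w 0) * ((w h - w (- h)) / (2 * h)) = (\<bar>w h\<bar> - \<bar>w (- h)\<bar>) / (2 * h)"
        using eventually_sgn_eq[OF c False] eventually_sgn_eq[OF c' False]
      proof eventually_elim
        case (elim h)
        have "\<bar>w h\<bar> = sgn (w 0) * w h" "\<bar>w (- h)\<bar> = sgn (w 0) * w (- h)"
          using abs_sgn[of "w h"] abs_sgn[of "w (- h)"] by (simp_all only: elim mult.commute)
        then show ?case by (simp add: algebra_simps diff_divide_distrib)
      qed
    qed
  qed
qed

text \<open>
  The weak gradient of the polarization. The arithmetic mean of the two gradients is taken where
  \<open>u\<close> and its reflection agree, being the limit of the symmetric difference quotients away from the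
  null set where \<^const>\<open>half_sign\<close> vanishes.
\<close>

definition polar_grad :: "real \<Rightarrow> real \<Rightarrow> 'n \<Rightarrow> (real ^ 'n \<Rightarrow> real) \<Rightarrow> real ^ 'n \<Rightarrow> real ^ 'n" where
  "polar_grad l a i u x =
     ((1 + polar_sign l a i u x) / 2) *\<^sub>R grad u x +
     ((1 - polar_sign l a i u x) / 2) *\<^sub>R grad (\<lambda>y. u (reflect a i y)) x"

text \<open>The standing assumptions on the function to be polarized.\<close>

locale periodic_C2 =
  fixes l :: real and u :: "real ^ 'n \<Rightarrow> real"
  assumes l: "0 < l" and C2: "Ck 2 u" and per: "periodic l u"
begin

lemma C1: "Ck (Suc 1) u"
  using C2 by (simp only: One_nat_def numeral_2_eq_2)

lemma cont: "continuous_on UNIV u"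
  using C2 by (rule Ck_imp_continuous)

lemma cont_refl: "continuous_on UNIV (\<lambda>x. u (reflect a i x))"
  using Ck_imp_continuous[OF Ck_reflect[OF C1]] .

lemma measurable_u [measurable]: "u \<in> borel_measurable borel"
  using cont by (rule borel_measurable_continuous_onI)

lemma measurable_half_sign [measurable]: "half_sign l a i \<in> borel_measurable borel"
  using continuous_on_half_sign by (rule borel_measurable_continuous_onI)

lemma measurable_polar_sign [measurable]: "polar_sign l a i u \<in> borel_measurable borel"
  unfolding polar_sign_def refl_diff_def by measurable

lemma measurable_polarize [measurable]: "polarize l a i u \<in> borel_measurable borel"
  unfolding polarize_def by measurable

lemma measurable_grad [measurable]: "grad u \<in> borel_measurable borel"
  "grad (\<lambda>x. u (reflect a i x)) \<in> borel_measurable borel"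
  using continuous_on_grad[OF C1] continuous_on_grad[OF Ck_reflect[OF C1]]
  by (auto intro: borel_measurable_continuous_onI)

lemma measurable_polar_grad [measurable]: "polar_grad l a i u \<in> borel_measurable borel"
  unfolding polar_grad_def by measurable

lemma grad_bounded:
  obtains K where "\<And>x. norm (grad u x) \<le> K" "0 \<le> K"
  using periodic_bounded[OF l, of "\<lambda>x. norm (grad u x)"]
    continuous_on_norm[OF continuous_on_grad[OF C1]] periodic_grad[OF C1 per]
  by (auto simp: periodic_def)

lemma polarize_eq:
  "polarize l a i u x = (u x + u (reflect a i x)) / 2
     + sgn (half_sign l a i x) * \<bar>refl_diff a i u x\<bar> / 2"
proof (cases "half_sign l a i x = 0")
  case True
  then show ?thesis
    using refl_diff_eq_0[OF l per True] by (simp add: polarize_def polar_sign_def refl_diff_def)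
next
  case False
  then show ?thesis
    by (auto simp: polarize_def polar_sign_def refl_diff_def sgn_real_def
        zero_le_mult_iff mult_le_0_iff zero_less_mult_iff field_simps split: if_splits)
qed

lemma continuous_on_polarize: "continuous_on UNIV (polarize l a i u)"
proof -
  let ?s = "half_sign l a i" and ?w = "refl_diff a i u"
  have w: "continuous_on S ?w" for S
    unfolding refl_diff_def
    by (intro continuous_on_diff continuous_on_subset[OF cont] continuous_on_subset[OF cont_refl]) auto
  have cl: "closed {x. 0 \<le> ?s x}" "closed {x. ?s x \<le> 0}"
    using continuous_on_half_sign[of l a i] by (auto intro!: closed_Collect_le continuous_intros)
  have "continuous_on ({x. 0 \<le> ?s x} \<union> {x. ?s x \<le> 0}) (\<lambda>x. if 0 \<le> ?s x then \<bar>?w x\<bar> else - \<bar>?w x\<bar>)"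
    by (rule continuous_on_cases[OF cl])
      (use refl_diff_eq_0[OF l per] in \<open>force intro!: continuous_intros w\<close>)+
  moreover have "{x. 0 \<le> ?s x} \<union> {x. ?s x \<le> 0} = UNIV" by auto
  moreover have "sgn (?s x) * \<bar>?w x\<bar> = (if 0 \<le> ?s x then \<bar>?w x\<bar> else - \<bar>?w x\<bar>)" for x
    using refl_diff_eq_0[OF l per, of a i x] by (auto simp: sgn_real_def)
  ultimately have sw: "continuous_on UNIV (\<lambda>x. sgn (?s x) * \<bar>?w x\<bar>)" by simp
  show ?thesis
    unfolding polarize_eq[abs_def]
    by (intro continuous_on_add continuous_on_divide continuous_on_const cont cont_refl sw) auto
qed

lemma periodic_polar_sign: "periodic l (polar_sign l a i u)"
  using periodic_half_sign[OF l, of a i] per periodic_reflect[OF per, of a i]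
  by (simp add: periodic_def polar_sign_def refl_diff_def)

lemma periodic_polarize: "periodic l (polarize l a i u)"
  using periodic_polar_sign per periodic_reflect[OF per, of a i]
  by (simp add: periodic_def polarize_def)

lemma periodic_polar_grad: "periodic l (polar_grad l a i u)"
  using periodic_polar_sign periodic_grad[OF C1 per]
    periodic_grad[OF Ck_reflect[OF C1] periodic_reflect[OF per], of a i]
  by (simp add: periodic_def polar_grad_def)

lemma abs_polar_sign: "\<bar>polar_sign l a i u x\<bar> \<le> 1"
  by (simp add: polar_sign_def sgn_real_def)

lemma u_lipschitz:
  assumes "\<And>x. norm (grad u x) \<le> K"
  shows "\<bar>u (x + axis j s) - u (x + axis j t)\<bar> \<le> K * \<bar>s - t\<bar>"
    "\<bar>u (reflect a i (x + axis j s)) - u (reflect a i (x + axis j t))\<bar> \<le> K * \<bar>s - t\<bar>"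
proof -
  have p: "\<bar>partial j u x\<bar> \<le> K" for x j
    using order_trans[OF component_le_norm_cart assms, of x j] by (simp add: grad_def)
  show "\<bar>u (x + axis j s) - u (x + axis j t)\<bar> \<le> K * \<bar>s - t\<bar>" for x s t
    by (rule Ck_lipschitz_line[OF C1 p])
  from this[of "reflect a i x" "if j = i then - s else s" "if j = i then - t else t"]
  show "\<bar>u (reflect a i (x + axis j s)) - u (reflect a i (x + axis j t))\<bar> \<le> K * \<bar>s - t\<bar>"
    by (auto simp: reflect_add_axis abs_minus_commute)
qed

text \<open>
  Polarization does not jump across the hyperplanes that separate the slabs, because \<^const>\<open>refl_diff\<close>
  vanishes there.
\<close>

lemma polarize_lipschitz:
  assumes K: "\<And>x. norm (grad u x) \<le> K"
  shows "\<bar>polarize l a i u (x + axis j h) - polarize l a i u x\<bar> \<le> 2 * K * \<bar>h\<bar>"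
proof -
  define \<sigma> where "\<sigma> t = half_sign l a i (x + axis j t)" for t
  define w where "w t = refl_diff a i u (x + axis j t)" for t
  have \<sigma>: "continuous_on UNIV \<sigma>"
    unfolding \<sigma>_def half_sign_def using l by (cases "j = i") (auto simp: axis_nth_eq intro!: continuous_intros)
  have w: "\<bar>w s - w t\<bar> \<le> 2 * K * \<bar>s - t\<bar>" for s t
    using u_lipschitz(1)[OF K, of x j s t] u_lipschitz(2)[OF K, of a i x j s t] by (simp add: w_def refl_diff_def)
  have "\<bar>sgn (\<sigma> h) * \<bar>w h\<bar> - sgn (\<sigma> 0) * \<bar>w 0\<bar>\<bar> \<le> 2 * K * \<bar>h - 0\<bar>"
    by (rule signed_abs_lipschitz[OF \<sigma> w])
      (use refl_diff_eq_0[OF l per] in \<open>auto simp: \<sigma>_def w_def\<close>)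
  moreover have "\<bar>u (x + axis j h) - u x\<bar> \<le> K * \<bar>h\<bar>"
    "\<bar>u (reflect a i (x + axis j h)) - u (reflect a i x)\<bar> \<le> K * \<bar>h\<bar>"
    using u_lipschitz(1)[OF K, of x j h 0] u_lipschitz(2)[OF K, of a i x j h 0] by auto
  moreover have "\<bar>(p + q) / 2 + A / 2 - ((p' + q') / 2 + A' / 2)\<bar> \<le> 2 * k"
    if "\<bar>A - A'\<bar> \<le> 2 * k" "\<bar>p - p'\<bar> \<le> k" "\<bar>q - q'\<bar> \<le> k" for A A' p p' q q' k :: real
    using that unfolding abs_le_iff by (elim conjE, intro conjI) (simp_all add: field_simps)
  ultimately show ?thesis
    unfolding polarize_eq \<sigma>_def w_def add_axis_0 diff_0_right mult.assoc[of 2] by blast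
qed

lemma polarize_symmetric_derivative:
  assumes "half_sign l a i x \<noteq> 0"
  shows "((\<lambda>h. (polarize l a i u (x + axis j h) - polarize l a i u (x + axis j (- h))) / (2 * h))
     \<longlongrightarrow> polar_grad l a i u x $ j) (at 0)"
proof -
  let ?s = "half_sign l a i" and ?q = "\<lambda>x. u (reflect a i x)"
  let ?p' = "partial j u x" and ?q' = "partial j ?q x"
  define w where "w h = refl_diff a i u (x + axis j h)" for h
  have dp: "((\<lambda>h. u (x + axis j h)) has_real_derivative ?p') (at 0)"
    using Ck1_has_derivative_line[OF C1, of x j 0] by simp
  have dq: "((\<lambda>h. ?q (x + axis j h)) has_real_derivative ?q') (at 0)"
    using Ck1_has_derivative_line[OF Ck_reflect[OF C1], of a i x j 0] by simp
  have dw: "(w has_real_derivative (?p' - ?q')) (at 0)"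
    unfolding w_def refl_diff_def by (rule DERIV_diff[OF dp dq])
  define m where "m h = (u (x + axis j h) + ?q (x + axis j h)) / 2" for h
  have dm: "(m has_real_derivative ((?p' + ?q') / 2)) (at 0)"
    unfolding m_def by (intro DERIV_cdivide DERIV_add dp dq)
  have t: "((\<lambda>h. (m h - m (- h)) / (2 * h) + sgn (?s x) / 2 * ((\<bar>w h\<bar> - \<bar>w (- h)\<bar>) / (2 * h)))
      \<longlongrightarrow> (?p' + ?q') / 2 + sgn (?s x) / 2 * (sgn (w 0) * (?p' - ?q'))) (at 0)"
    by (intro tendsto_add tendsto_mult_left symmetric_derivative abs_symmetric_derivative dm dw)
  have lim_eq: "(?p' + ?q') / 2 + sgn (?s x) / 2 * (sgn (w 0) * (?p' - ?q'))
      = polar_grad l a i u x $ j"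
    by (simp add: polar_grad_def grad_def polar_sign_def sgn_mult w_def field_simps)
  have c: "isCont (\<lambda>h. ?s (x + axis j h)) 0"
    unfolding half_sign_def using l by (cases "j = i") (auto simp: axis_nth_eq intro!: continuous_intros)
  then have c1: "((\<lambda>h. ?s (x + axis j h)) \<longlongrightarrow> ?s x) (at 0)" by (simp add: isCont_def)
  have c2: "((\<lambda>h. ?s (x + axis j (- h))) \<longlongrightarrow> ?s x) (at 0)"
    using filterlim_compose[OF c1 filterlim_uminus_at_0] .
  have "\<forall>\<^sub>F h in at 0. (m h - m (- h)) / (2 * h) + sgn (?s x) / 2 * ((\<bar>w h\<bar> - \<bar>w (- h)\<bar>) / (2 * h))
      = (polarize l a i u (x + axis j h) - polarize l a i u (x + axis j (- h))) / (2 * h)"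
    using eventually_sgn_eq[OF c1 assms] eventually_sgn_eq[OF c2 assms]
  proof eventually_elim
    case (elim h)
    have "polarize l a i u (x + axis j h) = m h + sgn (?s x) * \<bar>w h\<bar> / 2"
      "polarize l a i u (x + axis j (- h)) = m (- h) + sgn (?s x) * \<bar>w (- h)\<bar> / 2"
      unfolding polarize_eq m_def w_def using elim(1,2) by simp_all
    then show ?case by (simp add: diff_divide_distrib add_divide_distrib algebra_simps)
  qed
  from Lim_transform_eventually[OF t this] show ?thesis by (simp only: lim_eq)
qed

lemma norm_polar_grad_le:
  assumes K: "\<And>x. norm (grad u x) \<le> K"
  shows "norm (polar_grad l a i u x) \<le> K"
proof -
  let ?k = "polar_sign l a i u x"
  have "norm (polar_grad l a i u x) \<le> (1 + ?k) / 2 * norm (grad u x)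
      + (1 - ?k) / 2 * norm (grad (\<lambda>y. u (reflect a i y)) x)"
    unfolding polar_grad_def using abs_polar_sign[of a i x]
    by (intro order_trans[OF norm_triangle_ineq]) simp
  also have "\<dots> \<le> (1 + ?k) / 2 * K + (1 - ?k) / 2 * K"
    unfolding norm_grad_reflect[OF C1] using abs_polar_sign[of a i x]
    by (intro add_mono mult_left_mono K) auto
  finally show ?thesis by (simp add: field_simps)
qed

lemma is_weak_gradient_polarize: "is_weak_gradient l (polarize l a i u) (polar_grad l a i u)"
proof -
  obtain K where K: "\<And>x. norm (grad u x) \<le> K" "0 \<le> K" using grad_bounded by blast
  show ?thesis
  proof (rule is_weak_gradientI[OF l continuous_on_polarize periodic_polarize])
    show "\<bar>polarize l a i u (x + axis j h) - polarize l a i u x\<bar> \<le> 2 * K * \<bar>h\<bar>" for j x h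
      by (rule polarize_lipschitz[OF K(1)])
    show "AE x in lborel. ((\<lambda>h. (polarize l a i u (x + axis j h)
        - polarize l a i u (x + axis j (- h))) / (2 * h)) \<longlongrightarrow> polar_grad l a i u x $ j) (at 0)" for j
      using AE_half_sign_neq_0[OF l, of a i]
      by eventually_elim (rule polarize_symmetric_derivative)
    show "norm (polar_grad l a i u x) \<le> K" for x by (rule norm_polar_grad_le[OF K(1)])
  qed measurable
qed

lemma is_weak_gradient_grad: "is_weak_gradient l u (grad u)"
proof -
  obtain K where K: "\<And>x. norm (grad u x) \<le> K" "0 \<le> K" using grad_bounded by blast
  show ?thesis
  proof (rule is_weak_gradientI[OF l cont per])
    show "\<bar>u (x + axis j h) - u x\<bar> \<le> K * \<bar>h\<bar>" for j x h
      using u_lipschitz(1)[OF K(1), of x j h 0] by simp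
    show "AE x in lborel. ((\<lambda>h. (u (x + axis j h) - u (x + axis j (- h))) / (2 * h))
        \<longlongrightarrow> grad u x $ j) (at 0)" for j
      using symmetric_derivative[OF Ck1_has_derivative_line[OF C1, of _ j 0]]
      by (simp add: grad_def)
    show "norm (grad u x) \<le> K" for x by (rule K(1))
  qed measurable
qed

lemma integral_polarize:
  fixes \<Phi> :: "real \<Rightarrow> real"
  assumes \<Phi>: "continuous_on UNIV \<Phi>"
  shows "(\<integral>x. \<Phi> (polarize l a i u x) \<partial>torus_measure l) = (\<integral>x. \<Phi> (u x) \<partial>torus_measure l)"
proof -
  let ?M = "torus_measure l :: (real ^ 'n) measure"
  let ?F = "polarize l a i u"
  have [measurable]: "\<Phi> \<in> borel_measurable borel" using \<Phi> by (rule borel_measurable_continuous_onI)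
  have per': "periodic l (\<lambda>x. \<Phi> (u x))" "periodic l (\<lambda>x. \<Phi> (?F x))"
    using per periodic_polarize by (auto simp: periodic_def)
  obtain K where K: "\<And>x. \<bar>\<Phi> (u x)\<bar> \<le> K" "0 \<le> K"
    using periodic_bounded[OF l per'(1)] continuous_on_compose2[OF \<Phi> cont] by blast
  have K': "\<bar>\<Phi> (?F x)\<bar> \<le> K" for x using K by (simp add: polarize_def)
  have int: "integrable ?M (\<lambda>x. \<Phi> (u x))" "integrable ?M (\<lambda>x. \<Phi> (u (reflect a i x)))"
    "integrable ?M (\<lambda>x. \<Phi> (?F x))" "integrable ?M (\<lambda>x. \<Phi> (?F (reflect a i x)))"
    by (rule integrable_torus[of _ K], measurable, simp add: K K')+
  have "2 * (\<integral>x. \<Phi> (?F x) \<partial>?M) = (\<integral>x. \<Phi> (?F x) \<partial>?M) + (\<integral>x. \<Phi> (?F (reflect a i x)) \<partial>?M)"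
    by (subst integral_torus_reflect[OF l _ K' per'(2)]) auto
  also have "\<dots> = (\<integral>x. \<Phi> (?F x) + \<Phi> (?F (reflect a i x)) \<partial>?M)"
    using int by simp
  also have "\<dots> = (\<integral>x. \<Phi> (u x) + \<Phi> (u (reflect a i x)) \<partial>?M)"
    by (rule Bochner_Integration.integral_cong) (auto simp: polarize_reflect, auto simp: polarize_def)
  also have "\<dots> = (\<integral>x. \<Phi> (u x) \<partial>?M) + (\<integral>x. \<Phi> (u (reflect a i x)) \<partial>?M)"
    using int by simp
  also have "\<dots> = 2 * (\<integral>x. \<Phi> (u x) \<partial>?M)"
    by (subst integral_torus_reflect[OF l _ K(1) per'(1)]) auto
  finally show ?thesis by simp
qed

text \<open>
  Convexity of the square bounds the sum of the two values at \<open>x\<close> and at its reflection by the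
  corresponding sum for the gradient of \<open>u\<close>.
\<close>

lemma integral_norm_polar_grad_le:
  "(\<integral>x. (norm (polar_grad l a i u x))\<^sup>2 \<partial>torus_measure l) \<le> (\<integral>x. (norm (grad u x))\<^sup>2 \<partial>torus_measure l)"
proof -
  let ?M = "torus_measure l :: (real ^ 'n) measure"
  let ?R = "reflect a i"
  define N where "N x = (norm (grad u x))\<^sup>2" for x
  define P where "P x = (norm (polar_grad l a i u x))\<^sup>2" for x
  have [measurable]: "N \<in> borel_measurable borel" "P \<in> borel_measurable borel"
    unfolding N_def P_def by measurable
  obtain K where K: "\<And>x. norm (grad u x) \<le> K" "0 \<le> K" using grad_bounded by blast
  have N: "\<bar>N x\<bar> \<le> K\<^sup>2" for x using K by (simp add: N_def power_mono)
  have P: "\<bar>P x\<bar> \<le> K\<^sup>2" for x using norm_polar_grad_le[OF K(1)] by (simp add: P_def power_mono)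
  have perN: "periodic l N" and perP: "periodic l P"
    using periodic_grad[OF C1 per] periodic_polar_grad by (auto simp: periodic_def N_def P_def)
  have int: "integrable ?M N" "integrable ?M (\<lambda>x. N (?R x))"
    "integrable ?M P" "integrable ?M (\<lambda>x. P (?R x))"
    by (rule integrable_torus[of _ "K\<^sup>2"], measurable, simp add: N P)+
  have convex: "(norm (((1 + k) / 2) *\<^sub>R v + ((1 - k) / 2) *\<^sub>R w))\<^sup>2
      \<le> (1 + k) / 2 * (norm v)\<^sup>2 + (1 - k) / 2 * (norm w)\<^sup>2" if "\<bar>k\<bar> \<le> 1" for k and v w :: "real ^ 'n"
  proof -
    have "norm (((1 + k) / 2) *\<^sub>R v + ((1 - k) / 2) *\<^sub>R w) \<le> (1 + k) / 2 * norm v + (1 - k) / 2 * norm w"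
      using that by (intro order_trans[OF norm_triangle_ineq]) simp
    then have "(norm (((1 + k) / 2) *\<^sub>R v + ((1 - k) / 2) *\<^sub>R w))\<^sup>2
        \<le> ((1 + k) / 2 * norm v + (1 - k) / 2 * norm w)\<^sup>2"
      by (intro power_mono) auto
    also have "\<dots> = (1 + k) / 2 * (norm v)\<^sup>2 + (1 - k) / 2 * (norm w)\<^sup>2
        - (1 + k) / 2 * ((1 - k) / 2) * (norm v - norm w)\<^sup>2"
      by (simp add: power2_eq_square field_simps)
    also have "\<dots> \<le> (1 + k) / 2 * (norm v)\<^sup>2 + (1 - k) / 2 * (norm w)\<^sup>2"
      using that by simp
    finally show ?thesis .
  qed
  have PR: "P y \<le> (1 + polar_sign l a i u y) / 2 * N y + (1 - polar_sign l a i u y) / 2 * N (?R y)" for y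
    unfolding P_def N_def polar_grad_def
    using convex[OF abs_polar_sign] norm_grad_reflect[OF C1] by metis
  have PP: "P x + P (?R x) \<le> N x + N (?R x)" for x
    using PR[of x] PR[of "?R x"] by (simp add: polar_sign_reflect field_simps)
  have "2 * (\<integral>x. P x \<partial>?M) = (\<integral>x. P x \<partial>?M) + (\<integral>x. P (?R x) \<partial>?M)"
    by (subst integral_torus_reflect[OF l _ P perP]) auto
  also have "\<dots> = (\<integral>x. P x + P (?R x) \<partial>?M)"
    using int by simp
  also have "\<dots> \<le> (\<integral>x. N x + N (?R x) \<partial>?M)"
    by (rule integral_mono) (use int PP in auto)
  also have "\<dots> = (\<integral>x. N x \<partial>?M) + (\<integral>x. N (?R x) \<partial>?M)"
    using int by simp
  also have "\<dots> = 2 * (\<integral>x. N x \<partial>?M)"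
    by (subst integral_torus_reflect[OF l _ N perN]) auto
  finally show ?thesis by (simp add: P_def N_def)
qed

end

lemma is_weak_gradient_weak_gradient:
  "is_weak_gradient l v g \<Longrightarrow> is_weak_gradient l v (weak_gradient l v)"
  unfolding weak_gradient_def by (rule someI[of "is_weak_gradient l v"])

lemma energy_eq_integral:
  fixes v :: "real ^ 'n \<Rightarrow> real"
  assumes l: "0 < l" and \<phi>: "0 < \<phi>" and g: "is_weak_gradient l v g" "g \<in> borel_measurable borel"
    and g_bd: "\<And>x. norm (g x) \<le> K"
    and G: "continuous_on UNIV G" "\<And>s. 0 \<le> G s" and v: "continuous_on UNIV v" "periodic l v"
  shows "energy \<phi> l G v = ennreal (\<phi> / 2 * (\<integral>x. (norm (g x))\<^sup>2 \<partial>torus_measure l)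
     + 1 / \<phi> * (\<integral>x. G (v x) \<partial>torus_measure l))"
proof -
  let ?M = "torus_measure l :: (real ^ 'n) measure"
  have Gv: "continuous_on UNIV (\<lambda>x. G (v x))" "periodic l (\<lambda>x. G (v x))"
    using continuous_on_compose2[OF G(1) v(1)] v(2) by (auto simp: periodic_def)
  obtain A where A: "\<And>x. \<bar>G (v x)\<bar> \<le> A" "0 \<le> A" using periodic_bounded[OF l Gv(2,1)] by blast
  have int: "integrable ?M (\<lambda>x. (norm (g x))\<^sup>2)" "integrable ?M (\<lambda>x. G (v x))"
    using g(1) integrable_torus[OF borel_measurable_continuous_onI[OF Gv(1)] A(1)]
    by (auto simp: is_weak_gradient_def)
  have "AE x in ?M. weak_gradient l v x = g x"
    by (rule weak_gradient_unique[OF l is_weak_gradient_weak_gradient[OF g(1)] g(1)])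
  then have "energy \<phi> l G v = (\<integral>\<^sup>+ x. ennreal (\<phi> / 2 * (norm (g x))\<^sup>2 + 1 / \<phi> * G (v x)) \<partial>?M)"
    unfolding energy_def by (intro nn_integral_cong_AE) (auto elim: eventually_mono)
  also have "\<dots> = ennreal (\<integral>x. \<phi> / 2 * (norm (g x))\<^sup>2 + 1 / \<phi> * G (v x) \<partial>?M)"
    by (rule nn_integral_eq_integral) (use int \<phi> G(2) in auto)
  also have "(\<integral>x. \<phi> / 2 * (norm (g x))\<^sup>2 + 1 / \<phi> * G (v x) \<partial>?M)
      = \<phi> / 2 * (\<integral>x. (norm (g x))\<^sup>2 \<partial>?M) + 1 / \<phi> * (\<integral>x. G (v x) \<partial>?M)"
    using int by simp
  finally show ?thesis .
qed

lemma minimizer_polarize: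
  fixes u :: "real ^ 'n \<Rightarrow> real"
  assumes l: "0 < l" and \<phi>: "0 < \<phi>" and C2: "Ck 2 u"
    and G: "continuous_on UNIV G" "\<And>s. 0 \<le> G s" and \<zeta>: "continuous_on UNIV \<zeta>"
    and min: "minimizer \<phi> l G \<zeta> \<omega> u"
  shows "minimizer \<phi> l G \<zeta> \<omega> (polarize l a i u)"
proof -
  have adm: "u \<in> admissible \<phi> l \<zeta> \<omega>" using min by (simp add: minimizer_def)
  then have per: "periodic l u" by (simp add: admissible_def W12_def)
  interpret periodic_C2 l u by standard (fact l C2 per)+
  let ?F = "polarize l a i u" and ?M = "torus_measure l :: (real ^ 'n) measure"
  obtain K where K: "\<And>x. norm (grad u x) \<le> K" "0 \<le> K" using grad_bounded by blast
  obtain A where A: "\<And>x. \<bar>?F x\<bar> \<le> A" "0 \<le> A"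
    using periodic_bounded[OF l periodic_polarize continuous_on_polarize] by blast
  have "(?F x)\<^sup>2 \<le> A\<^sup>2" for x using A(1)[of x] by (simp add: abs_le_square_iff[symmetric] A(2))
  then have "integrable ?M (\<lambda>x. (?F x)\<^sup>2)"
    by (intro integrable_torus[of _ "A\<^sup>2"]) auto
  then have "?F \<in> W12 l"
    using periodic_polarize measurable_torusI[OF measurable_polarize] is_weak_gradient_polarize
    unfolding W12_def by blast
  moreover have "torus_average l ?F = torus_average l u"
    using integral_polarize[OF continuous_on_id] by (simp add: torus_average_def)
  ultimately have F: "?F \<in> admissible \<phi> l \<zeta> \<omega>"
    using adm integral_polarize[OF \<zeta>] by (simp add: admissible_def)
  have "energy \<phi> l G ?F = ennreal (\<phi> / 2 * (\<integral>x. (norm (polar_grad l a i u x))\<^sup>2 \<partial>?M)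
     + 1 / \<phi> * (\<integral>x. G (?F x) \<partial>?M))"
    by (rule energy_eq_integral[OF l \<phi> is_weak_gradient_polarize _ norm_polar_grad_le[OF K(1)] G
          continuous_on_polarize periodic_polarize]) measurable
  also have "\<dots> \<le> ennreal (\<phi> / 2 * (\<integral>x. (norm (grad u x))\<^sup>2 \<partial>?M) + 1 / \<phi> * (\<integral>x. G (u x) \<partial>?M))"
    unfolding integral_polarize[OF G(1)]
    using integral_norm_polar_grad_le \<phi> by (intro ennreal_leI add_mono mult_left_mono) auto
  also have "\<dots> = energy \<phi> l G u"
    by (rule energy_eq_integral[OF l \<phi> is_weak_gradient_grad _ K(1) G cont per, symmetric]) measurable
  finally show ?thesis
    using min F unfolding minimizer_def by (blast intro: order_trans)
qed

section \<open>A boundary point lemma\<close>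

lemma second_derivative_nonneg_at_min:
  fixes f :: "real \<Rightarrow> real"
  assumes f: "\<And>s. (f has_real_derivative f' s) (at s)" and f'': "(f' has_real_derivative d) (at 0)"
    and r: "0 < r" and min: "\<And>s. \<bar>s\<bar> < r \<Longrightarrow> f 0 \<le> f s"
  shows "0 \<le> d"
proof (rule ccontr)
  assume "\<not> 0 \<le> d"
  have z: "f' 0 = 0" by (rule DERIV_local_min[OF f r]) (use min in auto)
  obtain e where e: "e > 0" "\<And>h. 0 < h \<Longrightarrow> h < e \<Longrightarrow> f' h < 0"
    using DERIV_neg_dec_right[OF f''] \<open>\<not> 0 \<le> d\<close> z by auto
  define h where "h = min r e / 2"
  have h: "0 < h" "h < r" "h < e" using r e by (auto simp: h_def)
  obtain c where c: "0 < c" "c < h" "f h - f 0 = (h - 0) * f' c"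
    using MVT2[of 0 h f f'] f h by auto
  have "(h - 0) * f' c < 0" using e(2)[of c] c h by (simp add: mult_pos_neg)
  then show False using min[of h] c(3) h by simp
qed

lemma axis_diff_norm:
  fixes x y :: "real ^ 'n"
  shows "(norm (x + axis i s - y))\<^sup>2 = (norm (x - y))\<^sup>2 + 2 * s * (x $ i - y $ i) + s\<^sup>2"
proof -
  have "(norm (x + axis i s - y))\<^sup>2 = ((x - y) + axis i s) \<bullet> ((x - y) + axis i s)"
    by (simp add: power2_norm_eq_inner algebra_simps)
  also have "\<dots> = (x - y) \<bullet> (x - y) + 2 * ((x - y) \<bullet> axis i s) + axis i s \<bullet> axis i s"
    by (simp add: inner_add_left inner_add_right inner_commute)
  also have "\<dots> = (norm (x - y))\<^sup>2 + 2 * s * (x $ i - y $ i) + s\<^sup>2"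
    by (simp add: power2_norm_eq_inner inner_axis axis_nth_eq power2_eq_square[of s])
  finally show ?thesis .
qed

text \<open>
  A variant of Hopf's lemma: a positive supersolution in a ball cannot vanish together with
  its derivative at a boundary point. The comparison function is
  \<open>exp (- \<alpha> |x - y|\<^sup>2) - exp (- \<alpha> \<rho>\<^sup>2)\<close> on the annulus \<open>\<rho>/2 \<le> |x - y| \<le> \<rho>\<close>.
\<close>

lemma hopf:
  fixes w :: "real ^ 'n \<Rightarrow> real"
  assumes C2: "Ck 2 w" and K: "0 \<le> K" and lap: "\<And>x. 0 < w x \<Longrightarrow> laplacian w x \<le> K * w x"
    and pos: "\<And>x. dist y x < \<rho> \<Longrightarrow> 0 < w x" and \<rho>: "0 < \<rho>" "dist y x0 = \<rho>" and w0: "w x0 = 0"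
  shows "\<not> (w has_derivative (\<lambda>_. 0)) (at x0)"
proof
  assume D0: "(w has_derivative (\<lambda>_. 0)) (at x0)"
  have C1: "Ck (Suc 1) w" using C2 by (simp only: One_nat_def numeral_2_eq_2)
  have cont: "continuous_on S w" for S
    using Ck_imp_continuous[OF C2] continuous_on_subset by blast
  have nonneg: "0 \<le> w x" if "dist y x \<le> \<rho>" for x
  proof -
    have "x \<in> closure (ball y \<rho>)" using that \<rho> by (simp add: closure_ball)
    then show ?thesis
      by (rule continuous_ge_on_closure[OF cont]) (use pos in \<open>auto intro: less_imp_le\<close>)
  qed
  define n where "n = real CARD('n)"
  \<comment> \<open>large enough for the comparison function to be a strict subsolution where \<open>|x - y| \<ge> \<rho>/2\<close>\<close>
  define \<alpha> where "\<alpha> = (2 * n + K + 1) / \<rho>\<^sup>2 + 1"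
  have \<alpha>1: "1 \<le> \<alpha>" using K \<rho> by (simp add: \<alpha>_def n_def)
  have \<alpha>2: "2 * n * \<alpha> + K < \<alpha>\<^sup>2 * \<rho>\<^sup>2"
  proof -
    have "\<alpha>\<^sup>2 * \<rho>\<^sup>2 = \<alpha> * (2 * n + K + 1 + \<rho>\<^sup>2)"
      using \<rho> by (simp add: \<alpha>_def power2_eq_square field_simps)
    also have "\<dots> = 2 * n * \<alpha> + \<alpha> * K + \<alpha> * (1 + \<rho>\<^sup>2)" by (simp add: algebra_simps)
    also have "\<dots> > 2 * n * \<alpha> + K"
    proof -
      have "0 < \<alpha> * (1 + \<rho>\<^sup>2)" using \<alpha>1 by (intro mult_pos_pos add_pos_nonneg) auto
      then show ?thesis using mult_right_mono[OF \<alpha>1 K] by simp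
    qed
    finally show ?thesis .
  qed
  define E where "E x = exp (- \<alpha> * (norm (x - y))\<^sup>2)" for x
  define b where "b x = E x - exp (- \<alpha> * \<rho>\<^sup>2)" for x
  have contb: "continuous_on S b" for S unfolding b_def E_def by (intro continuous_intros)
  have E: "0 < E x" "E x \<le> 1" for x using \<alpha>1 by (auto simp: E_def)
  have bE: "b x \<le> E x" for x by (simp add: b_def)
  obtain m where m: "0 < m" "\<And>x. norm (x - y) = \<rho> / 2 \<Longrightarrow> m \<le> w x"
  proof (cases "sphere y (\<rho> / 2) = {}")
    case True
    then show ?thesis using that[of 1] by (auto simp: sphere_def dist_norm norm_minus_commute)
  next
    case False
    then obtain p where p: "p \<in> sphere y (\<rho> / 2)" "\<And>x. x \<in> sphere y (\<rho> / 2) \<Longrightarrow> w p \<le> w x"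
      using continuous_attains_inf[OF compact_sphere False cont] by blast
    have "0 < w p" using p(1) \<rho> by (intro pos) auto
    then show ?thesis using that[of "w p"] p by (auto simp: dist_norm norm_minus_commute)
  qed
  define z where "z x = w x - m * b x" for x
  let ?A = "cball y \<rho> - ball y (\<rho> / 2)"
  have zA: "0 \<le> z x" if "x \<in> ?A" for x
  proof -
    have cA: "compact ?A" by (intro compact_diff compact_cball open_ball)
    have zc: "continuous_on ?A z" unfolding z_def by (intro continuous_intros cont contb)
    have ne: "?A \<noteq> {}" using that by (metis empty_iff)
    obtain p where pA: "p \<in> ?A" and pmin: "\<forall>x\<in>?A. z p \<le> z x"
      using continuous_attains_inf[OF cA ne zc] by (elim bexE)
    note p = pA pmin[rule_format]
    have "0 \<le> z p"
    proof (rule ccontr)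
      assume "\<not> 0 \<le> z p"
      then have neg: "w p < m * b p" by (simp add: z_def)
      define r where "r = norm (p - y)"
      have r: "\<rho> / 2 \<le> r" "r \<le> \<rho>" using p(1) by (auto simp: r_def dist_norm norm_minus_commute)
      have "r \<noteq> \<rho> / 2"
      proof
        assume "r = \<rho> / 2"
        then have "m \<le> w p" using m(2) by (simp add: r_def)
        moreover have "m * b p \<le> m * 1"
          using m(1) bE[of p] E(2)[of p] by (intro mult_left_mono) auto
        ultimately show False using neg by simp
      qed
      moreover have "r \<noteq> \<rho>"
      proof
        assume "r = \<rho>"
        then have "b p = 0" by (simp add: b_def E_def r_def)
        then show False using neg nonneg[of p] r by (simp add: r_def dist_norm norm_minus_commute)
      qed
      ultimately have r': "\<rho> / 2 < r" "r < \<rho>" using r by auto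
      have wp: "0 < w p" using r'(2) by (intro pos) (simp add: r_def dist_norm norm_minus_commute)
      define \<delta> where "\<delta> = min (r - \<rho> / 2) (\<rho> - r)"
      have \<delta>: "0 < \<delta>" using r' by (simp add: \<delta>_def)
      \<comment> \<open>the minimum of \<open>w - m b\<close> is interior, so its second derivatives along the axes are nonnegative\<close>
      have sec: "0 \<le> partial i (partial i w) p - m * (E p * (4 * \<alpha>\<^sup>2 * (p $ i - y $ i)\<^sup>2 - 2 * \<alpha>))" for i
      proof -
        define d where "d = p $ i - y $ i"
        define e where "e s = exp (- \<alpha> * (r\<^sup>2 + 2 * s * d + s\<^sup>2))" for s
        have Ee: "E (p + axis i s) = e s" for s
          unfolding E_def axis_diff_norm e_def r_def d_def ..
        have e': "(e has_real_derivative (- \<alpha> * (2 * d + 2 * s)) * e s) (at s)" for s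
        proof -
          have "((\<lambda>s. - \<alpha> * (r\<^sup>2 + 2 * s * d + s\<^sup>2)) has_real_derivative - \<alpha> * (2 * d + 2 * s)) (at s)"
            by (auto intro!: derivative_eq_intros)
          from DERIV_fun_exp[OF this]
          have "(e has_real_derivative e s * (- \<alpha> * (2 * d + 2 * s))) (at s)"
            by (simp only: e_def[abs_def])
          then show ?thesis by (simp only: mult.commute)
        qed
        have e'': "((\<lambda>s. (- \<alpha> * (2 * d + 2 * s)) * e s) has_real_derivative
            e 0 * (4 * \<alpha>\<^sup>2 * d\<^sup>2 - 2 * \<alpha>)) (at 0)"
          by (auto intro!: derivative_eq_intros e' simp: algebra_simps power2_eq_square)
        show ?thesis
        proof (rule second_derivative_nonneg_at_min[OF _ _ \<delta>])
          show "((\<lambda>s. z (p + axis i s)) has_real_derivative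
              partial i w (p + axis i s) - m * ((- \<alpha> * (2 * d + 2 * s)) * e s)) (at s)" for s
          proof -
            have "((\<lambda>s. e s - exp (- \<alpha> * \<rho>\<^sup>2)) has_real_derivative (- \<alpha> * (2 * d + 2 * s)) * e s) (at s)"
              using DERIV_diff[OF e' DERIV_const] by simp
            then show ?thesis
              unfolding z_def b_def Ee by (intro DERIV_diff DERIV_cmult Ck1_has_derivative_line[OF C1])
          qed
          have "((\<lambda>s. partial i w (p + axis i s)) has_real_derivative partial i (partial i w) p) (at 0)"
            using Ck1_has_derivative_line[of 0 "partial i w" p i 0] Ck_partial[OF C1, of i] by simp
          moreover have "E p = e 0" using Ee[of 0] by simp
          ultimately show "((\<lambda>s. partial i w (p + axis i s) - m * ((- \<alpha> * (2 * d + 2 * s)) * e s))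
              has_real_derivative partial i (partial i w) p - m * (E p * (4 * \<alpha>\<^sup>2 * (p $ i - y $ i)\<^sup>2 - 2 * \<alpha>))) (at 0)"
            unfolding d_def[symmetric] by (simp only:) (intro DERIV_diff DERIV_cmult e'')
          show "z (p + axis i 0) \<le> z (p + axis i s)" if "\<bar>s\<bar> < \<delta>" for s
          proof -
            have "\<bar>norm (p + axis i s - y) - r\<bar> \<le> norm (axis i s)"
              unfolding r_def using norm_triangle_ineq3[of "p + axis i s - y" "p - y"] by simp
            also have "\<dots> = \<bar>s\<bar>" by (simp add: norm_eq_sqrt_inner inner_axis axis_nth_eq)
            finally have "p + axis i s \<in> ?A"
              using that by (auto simp: \<delta>_def dist_norm norm_minus_commute[of y])
            then show ?thesis using p(2) by simp
          qed
        qed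
      qed
      have "(\<Sum>i\<in>UNIV. (p $ i - y $ i)\<^sup>2) = r\<^sup>2"
        by (simp add: r_def norm_vec_def L2_set_def sum_nonneg)
      then have "(\<Sum>i\<in>UNIV. partial i (partial i w) p - m * (E p * (4 * \<alpha>\<^sup>2 * (p $ i - y $ i)\<^sup>2 - 2 * \<alpha>)))
          = laplacian w p - m * (E p * (4 * \<alpha>\<^sup>2 * r\<^sup>2 - 2 * n * \<alpha>))"
        by (simp add: laplacian_def sum_subtractf sum_distrib_left[symmetric] n_def)
      then have "m * (E p * (4 * \<alpha>\<^sup>2 * r\<^sup>2 - 2 * n * \<alpha>)) \<le> laplacian w p"
        using sum_nonneg[of UNIV "\<lambda>i. partial i (partial i w) p - m * (E p * (4 * \<alpha>\<^sup>2 * (p $ i - y $ i)\<^sup>2 - 2 * \<alpha>))"] sec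
        by simp
      also have "\<dots> \<le> K * w p" by (rule lap[OF wp])
      also have "\<dots> \<le> K * (m * b p)" using neg K by (intro mult_left_mono) auto
      also have "\<dots> \<le> K * (m * E p)" using bE m K by (intro mult_left_mono) auto
      also have "\<dots> = m * (E p * K)" by simp
      finally have "4 * \<alpha>\<^sup>2 * r\<^sup>2 - 2 * n * \<alpha> \<le> K" using m(1) E(1)[of p] by simp
      moreover have "\<alpha>\<^sup>2 * \<rho>\<^sup>2 \<le> 4 * \<alpha>\<^sup>2 * r\<^sup>2"
      proof -
        have "\<rho>\<^sup>2 \<le> (2 * r)\<^sup>2" using r \<rho> by (intro power_mono) auto
        then have "\<alpha>\<^sup>2 * \<rho>\<^sup>2 \<le> \<alpha>\<^sup>2 * (2 * r)\<^sup>2" by (intro mult_left_mono) auto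
        then show ?thesis by (simp add: power_mult_distrib)
      qed
      ultimately show False using \<alpha>2 by simp
    qed
    then show ?thesis using p(2)[OF that] by simp
  qed
  \<comment> \<open>on the way from \<open>x0\<close> to \<open>y\<close> the function \<open>w\<close> stays flat while \<open>b\<close> increases at a positive rate\<close>
  define \<gamma> where "\<gamma> t = x0 + t *\<^sub>R (y - x0)" for t :: real
  have \<gamma>n: "norm (\<gamma> t - y) = \<rho> * \<bar>1 - t\<bar>" for t
  proof -
    have "\<gamma> t - y = (t - 1) *\<^sub>R (y - x0)" by (simp add: \<gamma>_def algebra_simps)
    then show ?thesis using \<rho>(2) by (simp add: dist_norm abs_minus_commute)
  qed
  have "(\<gamma> has_derivative (\<lambda>t. t *\<^sub>R (y - x0))) (at 0)"
    unfolding \<gamma>_def by (auto intro!: derivative_eq_intros)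
  then have "((\<lambda>t. w (\<gamma> t)) has_derivative (\<lambda>t. 0)) (at 0)"
    by (rule has_derivative_compose) (use D0 in \<open>simp add: \<gamma>_def\<close>)
  then have wd: "((\<lambda>t. w (\<gamma> t)) has_real_derivative 0) (at 0)"
    by (simp add: has_field_derivative_def lambda_zero)
  have bt: "b (\<gamma> t) = exp (- \<alpha> * \<rho>\<^sup>2 * (1 - t)\<^sup>2) - exp (- \<alpha> * \<rho>\<^sup>2)" for t
    by (simp add: b_def E_def \<gamma>n power_mult_distrib mult.assoc)
  have bd: "((\<lambda>t. b (\<gamma> t)) has_real_derivative 2 * \<alpha> * \<rho>\<^sup>2 * exp (- \<alpha> * \<rho>\<^sup>2)) (at 0)"
    unfolding bt by (auto intro!: derivative_eq_intros)
  have "((\<lambda>t. z (\<gamma> t)) has_real_derivative 0 - m * (2 * \<alpha> * \<rho>\<^sup>2 * exp (- \<alpha> * \<rho>\<^sup>2))) (at 0)"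
    unfolding z_def by (intro DERIV_diff DERIV_cmult wd bd)
  moreover have "0 - m * (2 * \<alpha> * \<rho>\<^sup>2 * exp (- \<alpha> * \<rho>\<^sup>2)) < 0"
    using m \<alpha>1 \<rho> by simp
  ultimately obtain e where e: "e > 0" "\<And>h. 0 < h \<Longrightarrow> h < e \<Longrightarrow> z (\<gamma> h) < z (\<gamma> 0)"
    using DERIV_neg_dec_right[of "\<lambda>t. z (\<gamma> t)"] by (metis add_0)
  define h where "h = min e 1 / 2"
  have h: "0 < h" "h < e" "h \<le> 1 / 2" using e by (auto simp: h_def)
  have "z (\<gamma> 0) = 0" by (simp add: z_def bt w0) (simp add: \<gamma>_def w0)
  moreover have "\<gamma> h \<in> ?A"
    using \<gamma>n[of h] h \<rho> by (simp add: dist_norm norm_minus_commute[of y])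
  ultimately show False using zA[of "\<gamma> h"] e(2)[of h] h by simp
qed

text \<open>
  If the set where \<open>w > 0\<close> were not relatively closed in \<open>H\<close>, then a largest ball inside that set,
  around a point close to a limit point \<open>p\<close> outside it, would touch a zero \<open>x0\<close> of \<open>w\<close> in \<open>H\<close>.
\<close>

lemma positive_of_flat_zeros:
  fixes w :: "real ^ 'n \<Rightarrow> real"
  assumes C2: "Ck 2 w" and K: "0 \<le> K" and lap: "\<And>x. 0 < w x \<Longrightarrow> laplacian w x \<le> K * w x"
    and H: "open H" "connected H"
    and flat: "\<And>x. x \<in> H \<Longrightarrow> w x = 0 \<Longrightarrow> (w has_derivative (\<lambda>_. 0)) (at x)"
    and y: "y \<in> H" "0 < w y" and x: "x \<in> H"
  shows "0 < w x"
proof -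
  have cont: "continuous_on S w" for S
    using Ck_imp_continuous[OF C2] continuous_on_subset by blast
  define U where "U = {x \<in> H. 0 < w x}"
  have "open {x. 0 < w x}" by (intro open_Collect_less cont continuous_on_const)
  then have opU: "openin (top_of_set H) U"
    unfolding U_def openin_open by blast
  have "H \<inter> closure U \<subseteq> U"
  proof
    fix p assume p: "p \<in> H \<inter> closure U"
    show "p \<in> U"
    proof (rule ccontr)
      assume "p \<notin> U"
      obtain e where e: "0 < e" "ball p e \<subseteq> H" using H(1) p by (auto simp: open_contains_ball)
      have "\<forall>e>0. \<exists>y\<in>U. dist y p < e" using p by (simp add: closure_approachable)
      moreover have "0 < e / 2" using e(1) by simp
      ultimately obtain y' where y': "y' \<in> U" "dist y' p < e / 2" by blast
      let ?Z = "{x. w x \<le> 0}"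
      have "closed ?Z" by (intro closed_Collect_le cont continuous_on_const)
      moreover have pZ: "p \<in> ?Z" using p \<open>p \<notin> U\<close> by (auto simp: U_def)
      ultimately obtain x0 where x0: "x0 \<in> ?Z" "\<And>x. x \<in> ?Z \<Longrightarrow> dist y' x0 \<le> dist y' x"
        using distance_attains_inf[of ?Z y'] by blast
      define \<rho> where "\<rho> = dist y' x0"
      have "x0 \<noteq> y'" using x0(1) y'(1) by (auto simp: U_def)
      then have \<rho>: "0 < \<rho>" by (simp add: \<rho>_def)
      have pos: "0 < w x" if "dist y' x < \<rho>" for x
      proof (rule ccontr)
        assume "\<not> 0 < w x"
        then have "x \<in> ?Z" by simp
        from x0(2)[OF this] that show False by (simp add: \<rho>_def)
      qed
      have "dist p x0 \<le> dist p y' + dist y' x0" by (rule dist_triangle)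
      also have "\<dots> < e" using x0(2)[OF pZ] y'(2) by (simp add: dist_commute)
      finally have "x0 \<in> H" using e(2) by (simp add: subset_eq)
      have "0 \<le> w x0"
      proof -
        have "x0 \<in> closure (ball y' \<rho>)" using \<rho> by (simp add: closure_ball \<rho>_def)
        then show ?thesis
          by (rule continuous_ge_on_closure[OF cont]) (use pos in \<open>auto intro: less_imp_le\<close>)
      qed
      then have "w x0 = 0" using x0(1) by simp
      from hopf[OF C2 K lap pos \<rho> \<rho>_def[symmetric] this] flat[OF \<open>x0 \<in> H\<close> this]
      show False by (rule notE)
    qed
  qed
  moreover have "U \<subseteq> H \<inter> closure U" using closure_subset[of U] by (auto simp: U_def)
  ultimately have "closedin (top_of_set H) U"
    unfolding closedin_closed by (intro exI[of _ "closure U"]) simp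
  with opU H(2) have "U = {} \<or> U = H" unfolding connected_clopen by blast
  moreover have "y \<in> U" using y by (simp add: U_def)
  ultimately have "x \<in> U" using x by blast
  then show ?thesis by (simp add: U_def)
qed

lemma has_derivative_zero_of_abs:
  fixes w v :: "'a::real_normed_vector \<Rightarrow> real"
  assumes v: "v differentiable (at x)" and H: "open H" "x \<in> H" "\<And>y. y \<in> H \<Longrightarrow> v y = \<bar>w y\<bar>"
    and w: "w x = 0"
  shows "(w has_derivative (\<lambda>_. 0)) (at x)"
proof -
  obtain D where "(v has_derivative D) (at x)" using v by (auto simp: differentiable_def)
  then have D: "((\<lambda>y. \<bar>w y\<bar>) has_derivative D) (at x)"
    by (rule has_derivative_transform_within_open[OF _ H])
  have "D = (\<lambda>_. 0)"
    by (rule differential_zero_maxmin[of x UNIV "\<lambda>y. \<bar>w y\<bar>"]) (use D w in auto)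
  with D show ?thesis
    by (simp add: has_derivative_iff_norm w)
qed

section \<open>The dichotomy for reflections\<close>

lemma partial_diff:
  fixes f g :: "real ^ 'n \<Rightarrow> real"
  assumes "Ck (Suc k) f" "Ck (Suc k) g"
  shows "partial j (\<lambda>x. f x - g x) = (\<lambda>x. partial j f x - partial j g x)"
proof
  fix x
  have "Ck (Suc k) (\<lambda>x. f x + - 1 * g x)" by (intro Ck_add Ck_cmult assms)
  then have "Ck (Suc k) (\<lambda>x. f x - g x)" by simp
  then show "partial j (\<lambda>x. f x - g x) x = partial j f x - partial j g x"
    by (rule partial_unique)
      (use DERIV_diff[OF Ck1_has_derivative_line[OF assms(1), of x j 0] Ck1_has_derivative_line[OF assms(2), of x j 0]] in simp)
qed

lemma partial_cmult:
  fixes f :: "real ^ 'n \<Rightarrow> real"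
  assumes "Ck (Suc k) f"
  shows "partial j (\<lambda>x. c * f x) x = c * partial j f x"
  by (rule partial_unique[OF Ck_cmult[OF assms]])
    (use DERIV_cmult[OF Ck1_has_derivative_line[OF assms, of x j 0], of c] in simp)

lemma laplacian_reflect:
  fixes u :: "real ^ 'n \<Rightarrow> real"
  assumes "Ck (Suc (Suc k)) u"
  shows "laplacian (\<lambda>x. u (reflect a i x)) x = laplacian u (reflect a i x)"
proof -
  have "partial j (partial j (\<lambda>x. u (reflect a i x))) x = partial j (partial j u) (reflect a i x)" for j
  proof -
    have p: "Ck (Suc k) (partial j u)" by (rule Ck_partial[OF assms])
    have "partial j (\<lambda>x. u (reflect a i x)) = (\<lambda>x. (if j = i then -1 else 1) * partial j u (reflect a i x))"
      using partial_reflect[OF assms] by blast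
    then show ?thesis
      using partial_cmult[OF Ck_reflect[OF p]] partial_reflect[OF p] by simp
  qed
  then show ?thesis by (simp add: laplacian_def)
qed

lemma Ck1_real_lipschitz:
  fixes f :: "real \<Rightarrow> real"
  assumes "Ck 1 f"
  obtains K where "0 \<le> K" "\<And>s t. \<bar>s\<bar> \<le> M \<Longrightarrow> \<bar>t\<bar> \<le> M \<Longrightarrow> \<bar>f s - f t\<bar> \<le> K * \<bar>s - t\<bar>"
proof -
  define f' where "f' x = frechet_derivative f (at x) 1" for x
  have c: "continuous_on UNIV f'" using assms by (simp add: f'_def[abs_def])
  have d: "(f has_real_derivative f' x) (at x)" for x
  proof -
    have D: "(f has_derivative frechet_derivative f (at x)) (at x)"
      using assms by (simp add: frechet_derivative_works[symmetric])
    have "frechet_derivative f (at x) h = f' x * h" for h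
      using linear_scale[OF has_derivative_linear[OF D], of h 1] by (simp add: f'_def mult.commute)
    then have "frechet_derivative f (at x) = (*) (f' x)" by (rule ext)
    with D show ?thesis by (simp only: has_field_derivative_def)
  qed
  have "compact (f' ` {-M..M})"
    by (intro compact_continuous_image continuous_on_subset[OF c]) auto
  then obtain K where K: "\<forall>x\<in>{-M..M}. \<bar>f' x\<bar> \<le> K"
    using compact_imp_bounded[of "f' ` {-M..M}"] by (auto simp: bounded_iff)
  show ?thesis
  proof (rule that[of "\<bar>K\<bar>"])
    fix s t :: real assume "\<bar>s\<bar> \<le> M" "\<bar>t\<bar> \<le> M"
    then have st: "s \<in> {-M..M}" "t \<in> {-M..M}" by auto
    have "norm (f' z) \<le> \<bar>K\<bar>" if "z \<in> {-M..M}" for z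
      using order_trans[OF bspec[OF K that] abs_ge_self] by simp
    from field_differentiable_bound[OF _ has_field_derivative_at_within[OF d] this st]
    show "\<bar>f s - f t\<bar> \<le> \<bar>K\<bar> * \<bar>s - t\<bar>" by simp
  qed simp
qed

text \<open>
  The smoothness of the polarization is what excludes that \<open>u\<close> and its reflection cross
  transversally, and tangential crossings are excluded by the equation.
\<close>

lemma (in periodic_C2) reflection_dichotomy:
  assumes f: "Ck 1 f" and lap: "\<And>x. laplacian u x = f (u x)"
    and F: "Ck (Suc k) (polarize l a i u)"
  shows "(\<forall>x. a < x $ i \<and> x $ i < a + l \<longrightarrow> 0 \<le> refl_diff a i u x)
       \<or> (\<forall>x. a < x $ i \<and> x $ i < a + l \<longrightarrow> refl_diff a i u x \<le> 0)"
proof -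
  let ?w = "refl_diff a i u" and ?q = "\<lambda>x. u (reflect a i x)"
  define H where "H = {x :: real ^ 'n. a < x $ i \<and> x $ i < a + l}"
  have "H = {x. a < axis i 1 \<bullet> x} \<inter> {x. axis i 1 \<bullet> x < a + l}"
    by (auto simp: H_def inner_axis')
  then have H: "open H" "connected H"
    by (auto intro!: convex_connected convex_Int convex_halfspace_lt convex_halfspace_gt
        open_Int open_halfspace_lt open_halfspace_gt)
  have Cq: "Ck 2 ?q" by (rule Ck_reflect[OF C2])
  have w_eq: "?w = (\<lambda>x. u x - ?q x)" by (simp add: refl_diff_def fun_eq_iff)
  have "Ck 2 (\<lambda>x. u x + - 1 * ?q x)" by (intro Ck_add Ck_cmult C2 Cq)
  then have Cw: "Ck 2 ?w" by (simp add: w_eq)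
  have Cs: "Ck (Suc (Suc 0)) u" "Ck (Suc (Suc 0)) ?q" using C2 Cq by (simp_all only: numeral_2_eq_2)
  have "laplacian ?w x = laplacian u x - laplacian ?q x" for x
    unfolding w_eq laplacian_def partial_diff[OF Cs]
      partial_diff[OF Ck_partial[OF Cs(1)] Ck_partial[OF Cs(2)]]
    by (simp add: sum_subtractf)
  then have lw: "laplacian ?w x = f (u x) - f (?q x)" for x
    using lap laplacian_reflect[OF Cs(1)] by simp
  obtain M where M: "\<And>x. \<bar>u x\<bar> \<le> M" using periodic_bounded[OF l per cont] by blast
  obtain K where K: "0 \<le> K" "\<And>s t. \<bar>s\<bar> \<le> M \<Longrightarrow> \<bar>t\<bar> \<le> M \<Longrightarrow> \<bar>f s - f t\<bar> \<le> K * \<bar>s - t\<bar>"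
    using Ck1_real_lipschitz[OF f] by blast
  have lapw: "laplacian ?w x \<le> K * ?w x" if "0 < ?w x" for x
    using K(2)[OF M M, of x "reflect a i x"] that by (simp add: lw refl_diff_def)
  have flat: "(?w has_derivative (\<lambda>_. 0)) (at x)" if "x \<in> H" "?w x = 0" for x
  proof -
    let ?v = "\<lambda>x. 2 * polarize l a i u x - u x - ?q x"
    have v: "?v differentiable (at x)"
      using F Cs by (intro differentiable_diff differentiable_mult) auto
    have vw: "?v y = \<bar>?w y\<bar>" if "y \<in> H" for y
      using half_sign_pos[OF l, of a y i] that unfolding polarize_eq by (simp add: H_def refl_diff_def add_divide_distrib)
    show ?thesis
      by (rule has_derivative_zero_of_abs[where v = ?v, OF v H(1) that(1) vw that(2)])
  qed
  show ?thesis
  proof (cases "\<exists>y\<in>H. 0 < ?w y")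
    case True
    then have "0 < ?w x" if "x \<in> H" for x
      using positive_of_flat_zeros[OF Cw K(1) lapw H flat _ _ that] by blast
    then show ?thesis by (intro disjI1) (auto simp: H_def intro: less_imp_le)
  next
    case False
    then have "\<not> 0 < ?w x" if "x \<in> H" for x using that by blast
    then show ?thesis by (simp add: H_def not_less)
  qed
qed

section \<open>Families of periodic functions of one variable\<close>

lemma periodic_real_int:
  fixes f :: "real \<Rightarrow> 'b"
  assumes "\<And>s. f (s + p) = f s"
  shows "f (s + of_int k * p) = f s"
proof -
  have n: "f (s + of_nat n * p) = f s" for n s
  proof (induction n)
    case (Suc n)
    have "s + of_nat (Suc n) * p = (s + of_nat n * p) + p" by (simp add: algebra_simps)
    then show ?case using assms Suc by (simp only:)
  qed simp
  show ?thesis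
  proof (cases k)
    case (nonneg n)
    then show ?thesis using n by simp
  next
    case (neg n)
    have "f (s + of_int k * p + of_nat (Suc n) * p) = f (s + of_int k * p)" by (rule n)
    moreover have "s + of_int k * p + of_nat (Suc n) * p = s"
      unfolding neg by (simp add: algebra_simps)
    ultimately show ?thesis by (simp only:)
  qed
qed

text \<open>
  If every reflection, at every centre \<open>a\<close>, orders all members of the family in the same way, then
  the family has a common centre of symmetry around which all members are decreasing. The two
  closed sets of centres cover the line and are exchanged by the translation by \<open>l\<close>, hence they
  meet, which gives the symmetry; if they meet again inside \<open>(c, c + l)\<close>, then all members are
  constant, and otherwise one of them contains \<open>(c, c + l)\<close>, which gives the monotonicity.
\<close>

lemma symmetric_decreasing_centre:
  fixes g :: "'x \<Rightarrow> real \<Rightarrow> real"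
  assumes l: "0 < l" and cont: "\<And>x. continuous_on UNIV (g x)"
    and per: "\<And>x s. g x (s + 2 * l) = g x s"
    and dich: "\<And>a. (\<forall>x t. 0 \<le> t \<and> t \<le> l \<longrightarrow> g x (a - t) \<le> g x (a + t))
                 \<or> (\<forall>x t. 0 \<le> t \<and> t \<le> l \<longrightarrow> g x (a + t) \<le> g x (a - t))"
  obtains b where "\<And>x s. g x (b - s) = g x (b + s)"
    "\<And>x s t. 0 \<le> s \<Longrightarrow> s \<le> t \<Longrightarrow> t \<le> l \<Longrightarrow> g x (b + t) \<le> g x (b + s)"
proof -
  define P where "P = {a. \<forall>x t. 0 \<le> t \<and> t \<le> l \<longrightarrow> g x (a - t) \<le> g x (a + t)}"
  define N where "N = {a. \<forall>x t. 0 \<le> t \<and> t \<le> l \<longrightarrow> g x (a + t) \<le> g x (a - t)}"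
  have PD: "g x (a - t) \<le> g x (a + t)" if "a \<in> P" "0 \<le> t" "t \<le> l" for a x t
    using that by (simp add: P_def)
  have ND: "g x (a + t) \<le> g x (a - t)" if "a \<in> N" "0 \<le> t" "t \<le> l" for a x t
    using that by (simp add: N_def)
  have PN: "a \<in> P \<or> a \<in> N" for a using dich[of a] by (simp add: P_def N_def)
  have c: "continuous_on UNIV (\<lambda>a. g x (a + t))" "continuous_on UNIV (\<lambda>a. g x (a - t))" for x t
    by (rule continuous_on_compose2[OF cont]; auto intro!: continuous_intros)+
  have "P = (\<Inter>x. \<Inter>t\<in>{0..l}. {a. g x (a - t) \<le> g x (a + t)})"
    "N = (\<Inter>x. \<Inter>t\<in>{0..l}. {a. g x (a + t) \<le> g x (a - t)})"
    by (auto simp: P_def N_def)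
  then have cl: "closed P" "closed N"
    by (auto intro!: closed_INT closed_Collect_le c)
  have shift: "a + l \<in> P" if "a \<in> N" for a
    unfolding P_def
  proof (intro CollectI allI impI)
    fix x t assume t: "0 \<le> t \<and> t \<le> l"
    have e: "a + l - t = a + (l - t)" "a + l + t = (a - (l - t)) + 2 * l" by auto
    show "g x (a + l - t) \<le> g x (a + l + t)"
      unfolding e per using t by (intro ND[OF that]) auto
  qed
  have shift': "a + l \<in> N" if "a \<in> P" for a
    unfolding N_def
  proof (intro CollectI allI impI)
    fix x t assume t: "0 \<le> t \<and> t \<le> l"
    have e: "a + l - t = a + (l - t)" "a + l + t = (a - (l - t)) + 2 * l" by auto
    show "g x (a + l + t) \<le> g x (a + l - t)"
      unfolding e per using t by (intro PD[OF that]) auto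
  qed
  have "P \<noteq> {}" "N \<noteq> {}" using PN[of 0] shift shift' by auto
  then have "P \<inter> N \<noteq> {}"
    using connected_UNIV[where 'a = real] cl PN unfolding connected_closed
    by (metis Int_UNIV_right UNIV_eq_I Un_iff subset_UNIV inf_bot_right)
  then obtain c where cP: "c \<in> P" and cN: "c \<in> N" by auto
  have sym0: "g x (c - s) = g x (c + s)" if "\<bar>s\<bar> \<le> l" for x s
    using PD[OF cP, of "\<bar>s\<bar>" x] ND[OF cN, of "\<bar>s\<bar>" x] that by (cases "0 \<le> s") auto
  have sym: "g x (c - s) = g x (c + s)" for x s
  proof -
    define k where "k = \<lfloor>(s + l) / (2 * l)\<rfloor>"
    have k: "of_int k \<le> (s + l) / (2 * l)" "(s + l) / (2 * l) < of_int k + 1" by (auto simp: k_def)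
    define r where "r = s - of_int k * (2 * l)"
    have "\<bar>r\<bar> \<le> l" using k l by (auto simp: r_def field_simps abs_le_iff)
    moreover have "c - s = (c - r) + of_int (- k) * (2 * l)" "c + s = (c + r) + of_int k * (2 * l)"
      by (auto simp: r_def)
    ultimately show ?thesis using sym0[of r x] periodic_real_int[of "g x" "2 * l", OF per] by metis
  qed
  show ?thesis
  proof (cases "\<exists>b. 0 < b \<and> b < l \<and> c + b \<in> P \<and> c + b \<in> N")
    case True
    then obtain b where b: "0 < b" "b < l" "c + b \<in> P" "c + b \<in> N" by blast
    have p1: "g x (s + 2 * b) = g x s" if "\<bar>s + b - c\<bar> \<le> l" for x s
    proof -
      let ?t = "\<bar>s + b - c\<bar>"
      have "g x (c + b - ?t) = g x (c + b + ?t)"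
        using PD[OF b(3), of ?t x] ND[OF b(4), of ?t x] that by auto
      then have "g x (c + b - (s + b - c)) = g x (c + b + (s + b - c))" by (auto simp: abs_if split: if_splits)
      then have "g x (c - (s - c)) = g x (s + 2 * b)" by (simp add: algebra_simps)
      then show ?thesis using sym[of x "s - c"] by simp
    qed
    have p2: "g x (s + 2 * b) = g x s" for x s
    proof -
      define k where "k = \<lfloor>(s + b - c + l) / (2 * l)\<rfloor>"
      have k: "of_int k \<le> (s + b - c + l) / (2 * l)" "(s + b - c + l) / (2 * l) < of_int k + 1"
        by (auto simp: k_def)
      define r where "r = s - of_int k * (2 * l)"
      have "\<bar>r + b - c\<bar> \<le> l" using k l by (auto simp: r_def field_simps abs_le_iff)
      moreover have "s = r + of_int k * (2 * l)" "s + 2 * b = (r + 2 * b) + of_int k * (2 * l)"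
        by (auto simp: r_def)
      ultimately show ?thesis using p1[of r x] periodic_real_int[of "g x" "2 * l", OF per] by metis
    qed
    \<comment> \<open>a period not larger than \<open>l\<close> makes every number a centre of symmetry\<close>
    obtain p where p: "0 < p" "p \<le> l" "\<And>x s. g x (s + p) = g x s"
    proof (cases "2 * b \<le> l")
      case True
      then show ?thesis using that[of "2 * b"] b p2 by auto
    next
      case False
      have "g x (s + (2 * l - 2 * b)) = g x s" for x s
        using p2[of x "s + (2 * l - 2 * b)"] per[of x s] by (simp add: algebra_simps)
      then show ?thesis using that[of "2 * l - 2 * b"] b False by auto
    qed
    have refl: "g x (a - t) = g x (a + t)" if "0 \<le> t" "t \<le> p" for x a t
    proof -
      have "g x (a + (p - t)) = g x (a - t)" using p(3)[of x "a - t"] by (simp add: algebra_simps)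
      moreover have "g x (a - (p - t)) = g x (a + t)" using p(3)[of x "a - (p - t)"] by (simp add: algebra_simps)
      ultimately show ?thesis
        using PN[of a] PD[of a t x] ND[of a t x] PD[of a "p - t" x] ND[of a "p - t" x] that p by auto
    qed
    have const: "g x s = g x t" for x s t
    proof -
      define k where "k = \<lfloor>(s - t) / p\<rfloor>"
      have k: "of_int k \<le> (s - t) / p" "(s - t) / p < of_int k + 1" by (auto simp: k_def)
      define r where "r = s - t - of_int k * p"
      have r: "0 \<le> r" "r < p" using k p by (auto simp: r_def field_simps)
      have "g x s = g x (t + r)"
        using periodic_real_int[of "g x" p "t + r" k] p(3) by (simp add: r_def)
      also have "\<dots> = g x t" using refl[of "r / 2" x "t + r / 2"] r by (simp add: add.commute)
      finally show ?thesis .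
    qed
    show ?thesis by (rule that[of c]) (use sym const in \<open>auto intro: eq_refl\<close>)
  next
    case False
    let ?I = "{c<..<c + l}"
    have disj: "P \<inter> N \<inter> ?I = {}"
    proof -
      have "\<not> (a \<in> P \<and> a \<in> N)" if "c < a" "a < c + l" for a
        using False[simplified, rule_format, of "a - c"] that by auto
      then show ?thesis by auto
    qed
    have "P \<inter> ?I = {} \<or> N \<inter> ?I = {}"
      using connected_Ioo[of c "c + l"] cl disj PN unfolding connected_closed by blast
    then consider "?I \<subseteq> N" | "?I \<subseteq> P" using PN by blast
    then show ?thesis
    proof cases
      case 1
      show ?thesis
      proof (rule that[of c])
        show "g x (c + t) \<le> g x (c + s)" if "0 \<le> s" "s \<le> t" "t \<le> l" for x s t
        proof (cases "s = t")
          case False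
          then have "c + (s + t) / 2 \<in> N" using 1 that by auto
          from ND[OF this, of "(t - s) / 2" x]
          have "g x (c + (s + t) / 2 + (t - s) / 2) \<le> g x (c + (s + t) / 2 - (t - s) / 2)"
            using that by simp
          moreover have "c + (s + t) / 2 + (t - s) / 2 = c + t" "c + (s + t) / 2 - (t - s) / 2 = c + s"
            by (simp_all add: field_simps)
          ultimately show ?thesis by (simp only:)
        qed simp
      qed (rule sym)
    next
      case 2
      have f: "g x (c + l + s) = g x (c + (l - s))" for x s
        using sym[of x "l + s"] per[of x "c - (l + s)"] by (simp add: algebra_simps)
      show ?thesis
      proof (rule that[of "c + l"])
        show "g x (c + l - s) = g x (c + l + s)" for x s
          unfolding f by (simp add: algebra_simps)
        show "g x (c + l + t) \<le> g x (c + l + s)" if "0 \<le> s" "s \<le> t" "t \<le> l" for x s t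
        proof (cases "s = t")
          case False
          then have "c + (l - t + (l - s)) / 2 \<in> P" using 2 that by auto
          from PD[OF this, of "(t - s) / 2" x]
          have "g x (c + (l - t + (l - s)) / 2 - (t - s) / 2) \<le> g x (c + (l - t + (l - s)) / 2 + (t - s) / 2)"
            using that by simp
          moreover have "c + (l - t + (l - s)) / 2 - (t - s) / 2 = c + (l - t)"
            "c + (l - t + (l - s)) / 2 + (t - s) / 2 = c + (l - s)"
            by (simp_all add: field_simps)
          ultimately show ?thesis unfolding f by (simp only:)
        qed simp
      qed
    qed
  qed
qed

section \<open>Steiner symmetrization of symmetric decreasing functions\<close>

text \<open>Replacing the coordinate \<open>i\<close> of \<open>x\<close> by \<open>s\<close>.\<close>

definition upd :: "'n \<Rightarrow> real ^ 'n \<Rightarrow> real \<Rightarrow> real ^ 'n" where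
  "upd i x s = (\<chi> j. if j = i then s else x $ j)"

lemma upd_nth: "upd i x s $ j = (if j = i then s else x $ j)"
  by (simp add: upd_def)

lemma upd_self: "upd i x (x $ i) = x"
  by (simp add: vec_eq_iff upd_nth)

lemma continuous_on_upd: "continuous_on S (upd i x)"
  unfolding upd_def
  by (intro continuous_on_vec_lambda, rename_tac j, case_tac "j = i") (auto intro!: continuous_intros)

text \<open>
  Symmetry in the coordinate \<open>i\<close> about \<open>0\<close>, and monotonicity in it on \<open>[0, l]\<close>, which for a
  \<open>2l\<close>-periodic function is a half period.
\<close>

definition symmetric_decreasing :: "real \<Rightarrow> 'n \<Rightarrow> (real ^ 'n \<Rightarrow> real) \<Rightarrow> bool" where
  "symmetric_decreasing l i v \<longleftrightarrow> (\<forall>x s. v (upd i x (- s)) = v (upd i x s)) \<and>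
     (\<forall>x s t. 0 \<le> s \<and> s \<le> t \<and> t \<le> l \<longrightarrow> v (upd i x t) \<le> v (upd i x s))"

lemma steiner_symmetric_decreasing:
  fixes v :: "real ^ 'n \<Rightarrow> real"
  assumes cont: "continuous_on UNIV v" and v: "symmetric_decreasing l i v" and x: "x \<in> torus l"
  shows "steiner l i v x = v x"
proof -
  define k where "k s = v (upd i x s)" for s
  define q where "q = \<bar>x $ i\<bar>"
  have q: "0 \<le> q" "q \<le> l" using x by (auto simp: q_def torus_iff abs_le_iff minus_le_iff)
  have even: "k (- s) = k s" for s using v by (simp add: symmetric_decreasing_def k_def)
  have kabs: "k \<bar>s\<bar> = k s" for s using even[of s] by (simp add: abs_if)
  have dec: "k t \<le> k s" if "\<bar>s\<bar> \<le> \<bar>t\<bar>" "\<bar>t\<bar> \<le> l" for s t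
  proof -
    have "k \<bar>t\<bar> \<le> k \<bar>s\<bar>" using v that by (simp add: symmetric_decreasing_def k_def)
    then show ?thesis by (simp add: kabs)
  qed
  have kq: "k q = v x" by (simp add: q_def kabs) (simp add: k_def upd_self)
  have kc: "continuous_on UNIV k"
    unfolding k_def by (rule continuous_on_compose2[OF cont continuous_on_upd]) auto
  define S where "S t = {s. \<bar>s\<bar> \<le> l \<and> t < k s}" for t
  have slice: "slice i {y \<in> torus l. v y > t} x = S t" for t
    using x by (auto simp: slice_def S_def k_def upd_def[symmetric] torus_iff upd_nth abs_le_iff minus_le_iff)
  have "S t = {- l..l} \<inter> {s. t < k s}" for t
    by (auto simp: S_def)
  moreover have "open {s. t < k s}" for t by (intro open_Collect_less kc continuous_on_const)
  ultimately have Sm: "S t \<in> lmeasurable" for t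
    by (simp add: fmeasurable_Int_fmeasurable lmeasurable_cbox[of "- l" l, simplified])
  have mem: "x \<in> steiner_set l i {y \<in> torus l. v y > t} \<longleftrightarrow> S t \<noteq> {} \<and> q \<le> measure lebesgue (S t) / 2" for t
    using x by (simp add: steiner_set_def slice q_def)
  have below: "x \<in> steiner_set l i {y \<in> torus l. v y > t}" if "t < v x" for t
  proof -
    have sub: "{- q..q} \<subseteq> S t"
    proof
      fix s assume "s \<in> {- q..q}"
      then have "\<bar>s\<bar> \<le> \<bar>q\<bar>" by auto
      then show "s \<in> S t" using dec[of s q] q that kq by (simp add: S_def)
    qed
    have "measure lebesgue {- q..q} \<le> measure lebesgue (S t)"
      by (rule measure_mono_fmeasurable[OF sub _ Sm]) simp
    moreover have "S t \<noteq> {}" using sub q by auto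
    ultimately show ?thesis unfolding mem using q by simp
  qed
  \<comment> \<open>at a level above \<open>v x\<close> the slice would lie strictly closer to the centre than \<open>x\<close>\<close>
  have above: "t \<le> v x" if "x \<in> steiner_set l i {y \<in> torus l. v y > t}" for t
  proof (rule ccontr)
    assume "\<not> t \<le> v x"
    then have t: "k q < t" by (simp add: kq)
    have ne: "S t \<noteq> {}" and m: "q \<le> measure lebesgue (S t) / 2" using that unfolding mem by auto
    obtain s where s: "\<bar>s\<bar> \<le> l" "t < k s" using ne by (auto simp: S_def)
    have "q \<noteq> 0"
    proof
      assume "q = 0"
      then have "k s \<le> k q" using s by (intro dec) auto
      then show False using s t by simp
    qed
    then have q0: "0 < q" using q by simp
    \<comment> \<open>by continuity the slice stays away from \<open>q\<close>\<close>
    have "\<forall>\<^sub>F s in at_left q. k s < t"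
    proof -
      have "isCont k q" using kc by (simp add: continuous_on_eq_continuous_at)
      then have "(k \<longlongrightarrow> k q) (at_left q)" by (simp add: isCont_def filterlim_at_split)
      then show ?thesis using t by (rule order_tendstoD(2))
    qed
    then have "\<exists>b<q. \<forall>s>b. s < q \<longrightarrow> k s < t" by (simp only: eventually_at_left_field)
    then obtain b where b: "b < q" "\<And>s. b < s \<Longrightarrow> s < q \<Longrightarrow> k s < t" by blast
    define r where "r = (max 0 b + q) / 2"
    have r: "0 \<le> r" "r < q" "k r < t" using b q0 by (auto simp: r_def intro!: b(2))
    have "S t \<subseteq> {- r..r}"
    proof
      fix s assume s: "s \<in> S t"
      have "\<bar>s\<bar> < r"
      proof (rule ccontr)
        assume "\<not> \<bar>s\<bar> < r"
        then have "k s \<le> k r" using s r by (intro dec) (auto simp: S_def)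
        then show False using s r by (simp add: S_def)
      qed
      then show "s \<in> {- r..r}" by auto
    qed
    then have "measure lebesgue (S t) \<le> measure lebesgue {- r..r}"
      by (rule measure_mono_fmeasurable) (use Sm in auto)
    then show False using m r by simp
  qed
  show ?thesis
    unfolding steiner_def
  proof (rule cSup_eq)
    show "t \<le> v x" if "t \<in> {t. x \<in> steiner_set l i {y \<in> torus l. v y > t}}" for t
      using that above by simp
    show "v x \<le> y" if "\<And>t. t \<in> {t. x \<in> steiner_set l i {y \<in> torus l. v y > t}} \<Longrightarrow> t \<le> y" for y
    proof (rule dense_le)
      fix t assume "t < v x"
      then show "t \<le> y" by (intro that CollectI below)
    qed
  qed
qed

text \<open>
  Steiner symmetrization only sees the values on the cell. The intermediate functions of the
  iteration are controlled nowhere else.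
\<close>

lemma steiner_cong:
  assumes "\<And>y. y \<in> torus l \<Longrightarrow> v y = w y"
  shows "steiner l i v x = steiner l i w x"
proof -
  have "{y \<in> torus l. v y > t} = {y \<in> torus l. w y > t}" for t using assms by auto
  then show ?thesis by (simp add: steiner_def)
qed

lemma iterated_steiner_symmetric_decreasing:
  fixes v :: "(real, 'n::{finite,linorder}) vec \<Rightarrow> real"
  assumes "continuous_on UNIV v" "\<And>i. symmetric_decreasing l i v" "x \<in> torus l"
  shows "iterated_steiner l v x = v x"
proof -
  have "foldr (steiner l) xs v x = v x" if "x \<in> torus l" for xs x
    using that
  proof (induction xs arbitrary: x)
    case (Cons i xs)
    have "steiner l i (foldr (steiner l) xs v) x = steiner l i v x"
      by (rule steiner_cong) (rule Cons.IH)
    then show ?case using steiner_symmetric_decreasing[OF assms(1,2) Cons.prems] by simp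
  qed simp
  then show ?thesis using assms(3) by (simp add: iterated_steiner_def)
qed

section \<open>Symmetry of minimizers\<close>

lemma continuous_AE_eq:
  fixes u v :: "'a::euclidean_space \<Rightarrow> real"
  assumes "continuous_on UNIV u" "continuous_on UNIV v" "AE x in lebesgue. v x = u x"
  shows "v = u"
proof (rule ccontr)
  assume "v \<noteq> u"
  then have "{x. v x \<noteq> u x} \<noteq> {}" by auto
  moreover have "open {x. v x \<noteq> u x}" by (intro open_Collect_neq assms)
  moreover have "negligible {x. v x \<noteq> u x}"
    using assms(3) by (simp add: eventually_ae_filter negligible_iff_null_sets)
      (metis completion.complete2 null_sets_completion_subset)
  ultimately show False using open_not_negligible by blast
qed

lemma Ck_deriv_real:
  fixes f :: "real \<Rightarrow> real"
  assumes "Ck (Suc k) f"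
  shows "Ck k (deriv f)"
proof -
  have "deriv f x = frechet_derivative f (at x) 1" for x
  proof -
    have D: "(f has_derivative frechet_derivative f (at x)) (at x)"
      using assms by (simp add: frechet_derivative_works[symmetric])
    have "frechet_derivative f (at x) h = frechet_derivative f (at x) 1 * h" for h
      using linear_scale[OF has_derivative_linear[OF D], of h 1] by (simp add: mult.commute)
    then have "frechet_derivative f (at x) = (*) (frechet_derivative f (at x) 1)" by (rule ext)
    with D have "(f has_real_derivative frechet_derivative f (at x) 1) (at x)"
      by (simp only: has_field_derivative_def)
    then show ?thesis by (rule DERIV_imp_deriv)
  qed
  then have "deriv f = (\<lambda>x. frechet_derivative f (at x) 1)" by (rule ext)
  then show ?thesis using assms by simp
qed

lemma (in periodic_C2) symmetric_decreasing_translate: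
  assumes f: "Ck 1 f" and lap: "\<And>x. laplacian u x = f (u x)"
    and F: "\<And>a i. Ck (Suc k) (polarize l a i u)"
  shows "\<exists>\<beta>\<in>torus l. \<forall>i. symmetric_decreasing l i (\<lambda>y. u (y + \<beta>))"
proof -
  have "\<exists>b. (\<forall>x s. u (upd i x (b - s)) = u (upd i x (b + s))) \<and>
      (\<forall>x s t. 0 \<le> s \<longrightarrow> s \<le> t \<longrightarrow> t \<le> l \<longrightarrow> u (upd i x (b + t)) \<le> u (upd i x (b + s)))" for i
  proof -
    let ?g = "\<lambda>x s. u (upd i x s)"
    have c: "continuous_on UNIV (?g x)" for x
      by (rule continuous_on_compose2[OF cont continuous_on_upd]) auto
    have p: "?g x (s + 2 * l) = ?g x s" for x s
    proof -
      have "upd i x (s + 2 * l) = upd i x s + axis i (2 * l)"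
        by (simp add: vec_eq_iff upd_nth axis_nth_eq)
      then show ?thesis using per by (simp add: periodic_def)
    qed
    have r: "refl_diff a i u (upd i x (a + t)) = ?g x (a + t) - ?g x (a - t)" for a x t
    proof -
      have "reflect a i (upd i x (a + t)) = upd i x (a - t)"
        by (simp add: vec_eq_iff upd_nth reflect_nth)
      then show ?thesis by (simp add: refl_diff_def)
    qed
    have pl: "?g x (a + l) = ?g x (a - l)" for a x using p[of x "a - l"] by (simp add: add.commute)
    have d: "(\<forall>x t. 0 \<le> t \<and> t \<le> l \<longrightarrow> ?g x (a - t) \<le> ?g x (a + t))
           \<or> (\<forall>x t. 0 \<le> t \<and> t \<le> l \<longrightarrow> ?g x (a + t) \<le> ?g x (a - t))" for a
      using reflection_dichotomy[OF f lap F, of a i]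
    proof
      assume A: "\<forall>x. a < x $ i \<and> x $ i < a + l \<longrightarrow> 0 \<le> refl_diff a i u x"
      have "?g x (a - t) \<le> ?g x (a + t)" if "0 \<le> t" "t \<le> l" for x t
        using A[rule_format, of "upd i x (a + t)"] that pl r
        by (cases "t = 0 \<or> t = l") (auto simp: upd_nth)
      then show ?thesis by blast
    next
      assume A: "\<forall>x. a < x $ i \<and> x $ i < a + l \<longrightarrow> refl_diff a i u x \<le> 0"
      have "?g x (a + t) \<le> ?g x (a - t)" if "0 \<le> t" "t \<le> l" for x t
        using A[rule_format, of "upd i x (a + t)"] that pl r
        by (cases "t = 0 \<or> t = l") (auto simp: upd_nth)
      then show ?thesis by blast
    qed
    show ?thesis
      by (rule symmetric_decreasing_centre[of l ?g, OF l c p d]) blast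
  qed
  then obtain b where b: "\<And>i x s. u (upd i x (b i - s)) = u (upd i x (b i + s))"
    "\<And>i x s t. 0 \<le> s \<Longrightarrow> s \<le> t \<Longrightarrow> t \<le> l \<Longrightarrow> u (upd i x (b i + t)) \<le> u (upd i x (b i + s))"
    by metis
  obtain \<beta> k where \<beta>: "\<beta> \<in> torus l" "(\<chi> i. b i) = \<beta> + (\<chi> i. 2 * l * of_int (k i))"
    by (rule torus_representative[OF l])
  have e: "u (upd i x s + \<beta>) = u (upd i (x + \<beta>) (b i + s))" for i x s
  proof -
    have bi: "b i = \<beta> $ i + 2 * l * of_int (k i)"
      using \<beta>(2) by (simp add: vec_eq_iff)
    have "upd i (x + \<beta>) (b i + s) = (upd i x s + \<beta>) + axis i (2 * l * of_int (k i))"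
      by (simp add: vec_eq_iff upd_nth axis_nth_eq bi)
    then show ?thesis using periodic_axis_int[OF per] by (simp only:)
  qed
  have "symmetric_decreasing l i (\<lambda>y. u (y + \<beta>))" for i
    unfolding symmetric_decreasing_def e
    using b(1)[of i] b(2)[of _ _ i] by simp
  with \<beta>(1) show ?thesis by blast
qed

theorem theorem1p3:
  fixes L \<xi> \<phi> l \<omega> :: real
    and G \<zeta> :: "real \<Rightarrow> real"
    and u :: "(real, 'n::{finite,linorder}) vec \<Rightarrow> real"
  assumes "CARD('n) \<ge> 2"
    and "L > 0" and "\<xi> > 0"
    and "\<phi> = \<xi> * L powr (- (real CARD('n) / (real CARD('n) + 1)))"
    and "l = \<phi> * L / 2"
    and "double_well G"
    and "cutoff \<phi> \<zeta>"
    and "regular_minimizers \<phi> l G \<zeta> \<omega> TYPE('n)"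
    and "minimizer \<phi> l G \<zeta> \<omega> u"
    and "continuous_on UNIV u"
    and "closure {x. deriv \<zeta> (u x) \<noteq> 0} \<noteq> UNIV"
  shows "\<exists>\<beta>\<in>torus l. \<forall>x\<in>torus l.
           u (x + \<beta>) = iterated_steiner l (\<lambda>y. u (y + \<beta>)) x"
proof -
  have \<phi>: "0 < \<phi>" using assms(2-4) by simp
  then have l: "0 < l" unfolding assms(5) using assms(2) by simp
  have G: "Ck (Suc 1) G" "\<And>s. 0 \<le> G s" and \<zeta>: "Ck (Suc 1) \<zeta>"
    using assms(6,7) by (auto simp: double_well_def cutoff_def smooth_def numeral_2_eq_2 simp del: Ck.simps)
  have G\<zeta>_cont: "continuous_on UNIV G" "continuous_on UNIV \<zeta>"
    using Ck_imp_continuous[OF G(1)] Ck_imp_continuous[OF \<zeta>] by auto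
  have reg: "Ck 2 w \<and> (\<exists>\<mu> \<nu>. euler_lagrange \<phi> G \<zeta> \<mu> \<nu> w)"
    if w: "minimizer \<phi> l G \<zeta> \<omega> w" "continuous_on UNIV w" for w :: "(real, 'n) vec \<Rightarrow> real"
  proof -
    obtain v \<mu> \<nu> where v: "AE x in lebesgue. v x = w x" "Ck 2 v" "euler_lagrange \<phi> G \<zeta> \<mu> \<nu> v"
      using assms(8) w(1) unfolding regular_minimizers_def by blast
    have "v = w" by (rule continuous_AE_eq[OF w(2) Ck_imp_continuous[OF v(2)] v(1)])
    with v show ?thesis by blast
  qed
  obtain \<mu> \<nu> where C2: "Ck 2 u" and EL: "euler_lagrange \<phi> G \<zeta> \<mu> \<nu> u"
    using reg[OF assms(9,10)] by blast
  have per: "periodic l u"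
    using assms(9) by (simp add: minimizer_def admissible_def W12_def)
  interpret periodic_C2 l u by standard (fact l C2 per)+
  define f where "f t = 1 / \<phi>\<^sup>2 * deriv G t + 1 / \<phi> * (\<mu> + \<nu> * deriv \<zeta> t)" for t
  have f: "Ck 1 f"
    unfolding f_def by (intro Ck_add Ck_cmult Ck_const Ck_deriv_real G \<zeta>)
  have lap: "laplacian u x = f (u x)" for x
    using EL[unfolded euler_lagrange_def, rule_format, of x] by (simp add: f_def)
  have F: "Ck (Suc 1) (polarize l a i u)" for a i
    using reg[OF minimizer_polarize[OF l \<phi> C2 G\<zeta>_cont(1) G(2) G\<zeta>_cont(2) assms(9)] continuous_on_polarize]
    by (simp add: numeral_2_eq_2 del: Ck.simps)
  obtain \<beta> where \<beta>: "\<beta> \<in> torus l" "\<And>i. symmetric_decreasing l i (\<lambda>y. u (y + \<beta>))"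
    using symmetric_decreasing_translate[OF f lap F] by blast
  have "continuous_on UNIV (\<lambda>y. u (y + \<beta>))"
    by (rule continuous_on_compose2[OF assms(10)]) (auto intro!: continuous_intros)
  from iterated_steiner_symmetric_decreasing[OF this \<beta>(2)]
  have "u (x + \<beta>) = iterated_steiner l (\<lambda>y. u (y + \<beta>)) x" if "x \<in> torus l" for x
    using that by simp
  with \<beta>(1) show ?thesis by blast
qed

end
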